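(* Let $R$ be a $\tau_q$-Noetherian commutative ring. Then $$q\text{-}\dim(R)=q\text{-}\dim(R[x])=\dim(\mathrm{T}(R[x])).$$
   Context: All rings are commutative with identity; $R[x]$ is the polynomial ring in one variable, $\mathrm{T}(A)$ denotes the total quotient ring of a ring $A$, and $\dim$ is the Krull dimension. For a ring $A$, an ideal $I$ of $A$ is dense if $(0:_A I)=0$, and semi-regular if it contains a finitely generated dense ideal of $A$. Let $\mathcal{Q}$ be the set of all finitely generated semi-regular ideals of $A$. For an ideal $I$ of $A$ put $I_q=\{y\in \mathrm{E}_A(A)\mid Jy\subseteq I \text{ for some } J\in\mathcal{Q}\}$, where $\mathrm{E}_A(A)$ is the injective envelope of $A$ as an $A$-module. The ideal $I$ is a $q$-ideal of $A$ if $I_q\cap A=I$. A maximal $q$-ideal is an ideal maximal among the proper $q$-ideals of $A$; the set of maximal $q$-ideals is denoted $q\text{-}\mathrm{Max}(A)$. It coincides with the set of ideals maximal among the non-semi-regular ideals of $A$, and consists of prime ideals. The $q$-Krull dimension of $A$ is $q\text{-}\dim(A)=\sup\{\mathrm{ht}(\mathfrak{p})\mid \mathfrak{p}\in q\text{-}\mathrm{Max}(A)\}$. A ring $R$ is $\tau_q$-Noetherian if it satisfies the ascending chain condition on its $q$-ideals. *)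

theory Defs
  imports "HOL-Library.Extended_Nat" "HOL-Algebra.UnivPoly"
begin

section \<open>Modules and injective envelopes\<close>

definition module_hom ::
  "('a, 'r) ring_scheme \<Rightarrow> ('a, 'b, 'm) module_scheme \<Rightarrow> ('a, 'c, 'n) module_scheme \<Rightarrow> ('b \<Rightarrow> 'c) set"
  where "module_hom A M N = {f \<in> carrier M \<rightarrow> carrier N.
    (\<forall>x\<in>carrier M. \<forall>y\<in>carrier M. f (x \<oplus>\<^bsub>M\<^esub> y) = f x \<oplus>\<^bsub>N\<^esub> f y) \<and>
    (\<forall>a\<in>carrier A. \<forall>x\<in>carrier M. f (a \<odot>\<^bsub>M\<^esub> x) = a \<odot>\<^bsub>N\<^esub> f x)}"

definition regular_module :: "('a, 'r) ring_scheme \<Rightarrow> ('a, 'a) module"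
  where "regular_module A =
    \<lparr>carrier = carrier A, mult = mult A, one = one A, zero = zero A, add = add A,
      smult = mult A\<rparr>"

text \<open>
  HOL cannot quantify over the carrier types of the test modules inside a formula. The test
  modules \<open>M\<close>, \<open>N\<close> are therefore carried by the element type of the ring. This loses
  nothing: the inclusions of the ideals of \<open>A\<close> into \<open>A\<close> are among the tests, so by
  Baer's criterion the extension property then holds for \<open>A\<close>-modules on all types.
\<close>

definition injective_module :: "('a, 'r) ring_scheme \<Rightarrow> ('a, 'e, 'm) module_scheme \<Rightarrow> bool"
  where "injective_module A E \<longleftrightarrow> module A E \<and>
    (\<forall>(N :: ('a, 'a) module) (M :: ('a, 'a) module) i g.
      module A N \<and> module A M \<and>
      i \<in> module_hom A N M \<and> inj_on i (carrier N) \<and> g \<in> module_hom A N E \<longrightarrow>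
      (\<exists>h \<in> module_hom A M E. \<forall>x\<in>carrier N. h (i x) = g x))"

text \<open>
  The injective envelope of \<open>A\<close> is unique only up to isomorphism over \<open>A\<close>. It is given by
  an injective module \<open>E\<close> together with an essential embedding \<open>\<iota>\<close> of \<open>A\<close> into \<open>E\<close>, by
  which \<open>A\<close> is regarded as a submodule of \<open>E\<close>. The notions below that refer to \<open>E\<^sub>A(A)\<close> take
  the pair \<open>E\<close>, \<open>\<iota>\<close> as arguments.
\<close>

definition injective_envelope ::
  "('a, 'r) ring_scheme \<Rightarrow> ('a, 'e, 'm) module_scheme \<Rightarrow> ('a \<Rightarrow> 'e) \<Rightarrow> bool"
  where "injective_envelope A E \<iota> \<longleftrightarrow> injective_module A E \<and>
    \<iota> \<in> module_hom A (regular_module A) E \<and> inj_on \<iota> (carrier A) \<and>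
    (\<forall>N. submodule N A E \<and> N \<inter> \<iota> ` carrier A = {\<zero>\<^bsub>E\<^esub>} \<longrightarrow> N = {\<zero>\<^bsub>E\<^esub>})"


section \<open>Semi-regular ideals and \<open>q\<close>-ideals\<close>

definition fin_gen_ideal :: "('a, 'r) ring_scheme \<Rightarrow> 'a set \<Rightarrow> bool"
  where "fin_gen_ideal A I \<longleftrightarrow> (\<exists>S. finite S \<and> S \<subseteq> carrier A \<and> I = Idl\<^bsub>A\<^esub> S)"

definition dense_ideal :: "('a, 'r) ring_scheme \<Rightarrow> 'a set \<Rightarrow> bool"
  where "dense_ideal A I \<longleftrightarrow>
    ideal I A \<and> {a \<in> carrier A. \<forall>x\<in>I. a \<otimes>\<^bsub>A\<^esub> x = \<zero>\<^bsub>A\<^esub>} = {\<zero>\<^bsub>A\<^esub>}"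

definition semi_regular_ideal :: "('a, 'r) ring_scheme \<Rightarrow> 'a set \<Rightarrow> bool"
  where "semi_regular_ideal A I \<longleftrightarrow>
    ideal I A \<and> (\<exists>J. fin_gen_ideal A J \<and> dense_ideal A J \<and> J \<subseteq> I)"

definition fin_gen_semi_regular :: "('a, 'r) ring_scheme \<Rightarrow> 'a set set"
  where "fin_gen_semi_regular A = {J. fin_gen_ideal A J \<and> semi_regular_ideal A J}"

definition q_envelope ::
  "('a, 'r) ring_scheme \<Rightarrow> ('a, 'e, 'm) module_scheme \<Rightarrow> ('a \<Rightarrow> 'e) \<Rightarrow> 'a set \<Rightarrow> 'e set"
  where "q_envelope A E \<iota> I =
    {y \<in> carrier E. \<exists>J \<in> fin_gen_semi_regular A. \<forall>a\<in>J. a \<odot>\<^bsub>E\<^esub> y \<in> \<iota> ` I}"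

definition q_ideal ::
  "('a, 'r) ring_scheme \<Rightarrow> ('a, 'e, 'm) module_scheme \<Rightarrow> ('a \<Rightarrow> 'e) \<Rightarrow> 'a set \<Rightarrow> bool"
  where "q_ideal A E \<iota> I \<longleftrightarrow> ideal I A \<and> q_envelope A E \<iota> I \<inter> \<iota> ` carrier A = \<iota> ` I"

definition q_Max ::
  "('a, 'r) ring_scheme \<Rightarrow> ('a, 'e, 'm) module_scheme \<Rightarrow> ('a \<Rightarrow> 'e) \<Rightarrow> 'a set set"
  where "q_Max A E \<iota> = {P. q_ideal A E \<iota> P \<and> P \<noteq> carrier A \<and>
    (\<forall>I. q_ideal A E \<iota> I \<and> I \<noteq> carrier A \<and> P \<subseteq> I \<longrightarrow> I = P)}"

definition tau_q_noetherian ::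
  "('a, 'r) ring_scheme \<Rightarrow> ('a, 'e, 'm) module_scheme \<Rightarrow> ('a \<Rightarrow> 'e) \<Rightarrow> bool"
  where "tau_q_noetherian A E \<iota> \<longleftrightarrow>
    (\<forall>I :: nat \<Rightarrow> 'a set. (\<forall>n. q_ideal A E \<iota> (I n)) \<and> (\<forall>n. I n \<subseteq> I (Suc n)) \<longrightarrow>
      (\<exists>k. \<forall>n\<ge>k. I n = I k))"


section \<open>Dimensions\<close>

definition prime_chain :: "('a, 'r) ring_scheme \<Rightarrow> (nat \<Rightarrow> 'a set) \<Rightarrow> nat \<Rightarrow> bool"
  where "prime_chain A P n \<longleftrightarrow> (\<forall>i\<le>n. primeideal (P i) A) \<and> (\<forall>i<n. P i \<subset> P (Suc i))"

definition height :: "('a, 'r) ring_scheme \<Rightarrow> 'a set \<Rightarrow> enat"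
  where "height A p = Sup {enat n | n. \<exists>P. prime_chain A P n \<and> P n = p}"

text \<open>The suprema are taken in \<^typ>\<open>enat\<close>, where the empty supremum is \<open>0\<close>; this
  only concerns the zero ring.\<close>

definition krull_dim :: "('a, 'r) ring_scheme \<Rightarrow> enat"
  where "krull_dim A = Sup {enat n | n. \<exists>P. prime_chain A P n}"

definition q_dim ::
  "('a, 'r) ring_scheme \<Rightarrow> ('a, 'e, 'm) module_scheme \<Rightarrow> ('a \<Rightarrow> 'e) \<Rightarrow> enat"
  where "q_dim A E \<iota> = Sup (height A ` q_Max A E \<iota>)"


section \<open>The total quotient ring\<close>

definition regular_elements :: "('a, 'r) ring_scheme \<Rightarrow> 'a set"
  where "regular_elements A =
    {s \<in> carrier A. \<forall>a\<in>carrier A. a \<otimes>\<^bsub>A\<^esub> s = \<zero>\<^bsub>A\<^esub> \<longrightarrow> a = \<zero>\<^bsub>A\<^esub>}"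

definition frac_rel :: "('a, 'r) ring_scheme \<Rightarrow> (('a \<times> 'a) \<times> ('a \<times> 'a)) set"
  where "frac_rel A = {((a, s), (b, t)). a \<in> carrier A \<and> b \<in> carrier A \<and>
    s \<in> regular_elements A \<and> t \<in> regular_elements A \<and> a \<otimes>\<^bsub>A\<^esub> t = b \<otimes>\<^bsub>A\<^esub> s}"

definition fraction :: "('a, 'r) ring_scheme \<Rightarrow> 'a \<Rightarrow> 'a \<Rightarrow> ('a \<times> 'a) set"
  where "fraction A a s = frac_rel A `` {(a, s)}"

definition total_quotient_ring :: "('a, 'r) ring_scheme \<Rightarrow> ('a \<times> 'a) set ring"
  where "total_quotient_ring A =
    \<lparr>carrier = (carrier A \<times> regular_elements A) // frac_rel A,
     mult = (\<lambda>X Y. \<Union>(a, s)\<in>X. \<Union>(b, t)\<in>Y. fraction A (a \<otimes>\<^bsub>A\<^esub> b) (s \<otimes>\<^bsub>A\<^esub> t)),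
     one = fraction A \<one>\<^bsub>A\<^esub> \<one>\<^bsub>A\<^esub>,
     zero = fraction A \<zero>\<^bsub>A\<^esub> \<one>\<^bsub>A\<^esub>,
     add = (\<lambda>X Y. \<Union>(a, s)\<in>X. \<Union>(b, t)\<in>Y.
       fraction A (a \<otimes>\<^bsub>A\<^esub> t \<oplus>\<^bsub>A\<^esub> b \<otimes>\<^bsub>A\<^esub> s) (s \<otimes>\<^bsub>A\<^esub> t))\<rparr>"

context cring
begin

lemma regular_elementsD:
  assumes "s \<in> regular_elements R"
  shows "s \<in> carrier R" "\<And>a. a \<in> carrier R \<Longrightarrow> a \<otimes> s = \<zero> \<Longrightarrow> a = \<zero>"
  using assms by (auto simp: regular_elements_def)

lemma one_regular: "\<one> \<in> regular_elements R"
  by (auto simp: regular_elements_def)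

lemma mult_regular:
  assumes "s \<in> regular_elements R" "t \<in> regular_elements R"
  shows "s \<otimes> t \<in> regular_elements R"
proof -
  have s: "s \<in> carrier R" and t: "t \<in> carrier R"
    using assms by (auto dest: regular_elementsD)
  have "a = \<zero>" if "a \<in> carrier R" "a \<otimes> (s \<otimes> t) = \<zero>" for a
  proof -
    have "(a \<otimes> s) \<otimes> t = \<zero>" using that s t by (simp add: m_assoc)
    then have "a \<otimes> s = \<zero>" using regular_elementsD(2)[OF assms(2)] that(1) s by simp
    then show ?thesis using regular_elementsD(2)[OF assms(1)] that(1) by simp
  qed
  then show ?thesis using s t by (auto simp: regular_elements_def)
qed

lemma regular_cancel:
  assumes "s \<in> regular_elements R" "a \<in> carrier R" "b \<in> carrier R" "a \<otimes> s = b \<otimes> s"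
  shows "a = b"
proof -
  have s: "s \<in> carrier R" using assms(1) by (rule regular_elementsD)
  have "(a \<ominus> b) \<otimes> s = \<zero>"
    using assms(2-4) s by (simp add: minus_eq l_distr l_minus r_neg)
  then have "a \<ominus> b = \<zero>" using regular_elementsD(2)[OF assms(1)] assms(2,3) by simp
  moreover have "a = (a \<ominus> b) \<oplus> b" using assms(2,3) by (simp add: minus_eq a_assoc l_neg)
  ultimately show ?thesis using assms(3) by simp
qed

lemma equiv_frac_rel: "equiv (carrier R \<times> regular_elements R) (frac_rel R)"
proof (rule equivI)
  show "frac_rel R \<subseteq> (carrier R \<times> regular_elements R) \<times> (carrier R \<times> regular_elements R)"
    by (auto simp: frac_rel_def)
  show "refl_on (carrier R \<times> regular_elements R) (frac_rel R)"
    by (auto simp: refl_on_def frac_rel_def)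
  show "sym (frac_rel R)"
    by (auto simp: sym_def frac_rel_def)
  show "trans (frac_rel R)"
  proof (rule transI)
    fix x y z
    assume xy: "(x, y) \<in> frac_rel R" and yz: "(y, z) \<in> frac_rel R"
    obtain a s b t c u where eqs: "x = (a, s)" "y = (b, t)" "z = (c, u)"
      by (metis surj_pair)
    have c: "a \<in> carrier R" "b \<in> carrier R" "c \<in> carrier R"
      and r: "s \<in> regular_elements R" "t \<in> regular_elements R" "u \<in> regular_elements R"
      and e: "a \<otimes> t = b \<otimes> s" "b \<otimes> u = c \<otimes> t"
      using xy yz by (auto simp: frac_rel_def eqs)
    note r' = r[THEN regular_elementsD(1)]
    have "(a \<otimes> u) \<otimes> t = (a \<otimes> t) \<otimes> u" using c r' by (simp add: m_ac)
    also have "\<dots> = (b \<otimes> u) \<otimes> s" unfolding e(1) using c r' by (simp add: m_ac)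
    also have "\<dots> = (c \<otimes> s) \<otimes> t" unfolding e(2) using c r' by (simp add: m_ac)
    finally have "a \<otimes> u = c \<otimes> s" using regular_cancel[OF r(2)] c r' by simp
    then show "(x, z) \<in> frac_rel R" using c r by (auto simp: frac_rel_def eqs)
  qed
qed

lemma fraction_eq_iff:
  assumes "a \<in> carrier R" "b \<in> carrier R" "s \<in> regular_elements R" "t \<in> regular_elements R"
  shows "fraction R a s = fraction R b t \<longleftrightarrow> a \<otimes> t = b \<otimes> s"
  unfolding fraction_def using eq_equiv_class_iff[OF equiv_frac_rel, of "(a, s)" "(b, t)"] assms
  by (auto simp: frac_rel_def)

lemma fraction_closed:
  assumes "a \<in> carrier R" "s \<in> regular_elements R"
  shows "fraction R a s \<in> carrier (total_quotient_ring R)"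
  using assms by (auto simp: fraction_def total_quotient_ring_def intro: quotientI)

lemma fraction_cases:
  assumes "X \<in> carrier (total_quotient_ring R)"
  obtains a s where "a \<in> carrier R" "s \<in> regular_elements R" "X = fraction R a s"
  using assms by (auto simp: fraction_def total_quotient_ring_def elim!: quotientE)

lemma mult_fraction:
  assumes "a \<in> carrier R" "b \<in> carrier R" "s \<in> regular_elements R" "t \<in> regular_elements R"
  shows "fraction R a s \<otimes>\<^bsub>total_quotient_ring R\<^esub> fraction R b t = fraction R (a \<otimes> b) (s \<otimes> t)"
proof -
  have "congruent2 (frac_rel R) (frac_rel R)
      (\<lambda>x y. case x of (a, s) \<Rightarrow> case y of (b, t) \<Rightarrow> fraction R (a \<otimes> b) (s \<otimes> t))"
  proof (rule congruent2I', clarify)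
    fix a s a' s' b t b' t'
    assume 1: "((a, s), (a', s')) \<in> frac_rel R" and 2: "((b, t), (b', t')) \<in> frac_rel R"
    have c: "a \<in> carrier R" "a' \<in> carrier R" "b \<in> carrier R" "b' \<in> carrier R"
      and r: "s \<in> regular_elements R" "s' \<in> regular_elements R"
        "t \<in> regular_elements R" "t' \<in> regular_elements R"
      and e: "a \<otimes> s' = a' \<otimes> s" "b \<otimes> t' = b' \<otimes> t"
      using 1 2 by (auto simp: frac_rel_def)
    note r' = r[THEN regular_elementsD(1)]
    have "(a \<otimes> b) \<otimes> (s' \<otimes> t') = (a \<otimes> s') \<otimes> (b \<otimes> t')" using c r' by (simp add: m_ac)
    also have "\<dots> = (a' \<otimes> b') \<otimes> (s \<otimes> t)" unfolding e using c r' by (simp add: m_ac)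
    finally show "fraction R (a \<otimes> b) (s \<otimes> t) = fraction R (a' \<otimes> b') (s' \<otimes> t')"
      using fraction_eq_iff c r by (simp add: mult_regular)
  qed
  from UN_equiv_class2[OF equiv_frac_rel equiv_frac_rel this, of "(a, s)" "(b, t)"]
  show ?thesis using assms by (simp add: total_quotient_ring_def fraction_def case_prod_unfold)
qed

lemma add_fraction:
  assumes "a \<in> carrier R" "b \<in> carrier R" "s \<in> regular_elements R" "t \<in> regular_elements R"
  shows "fraction R a s \<oplus>\<^bsub>total_quotient_ring R\<^esub> fraction R b t = fraction R (a \<otimes> t \<oplus> b \<otimes> s) (s \<otimes> t)"
proof -
  have "congruent2 (frac_rel R) (frac_rel R)
      (\<lambda>x y. case x of (a, s) \<Rightarrow> case y of (b, t) \<Rightarrow> fraction R (a \<otimes> t \<oplus> b \<otimes> s) (s \<otimes> t))"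
  proof (rule congruent2I', clarify)
    fix a s a' s' b t b' t'
    assume 1: "((a, s), (a', s')) \<in> frac_rel R" and 2: "((b, t), (b', t')) \<in> frac_rel R"
    have c: "a \<in> carrier R" "a' \<in> carrier R" "b \<in> carrier R" "b' \<in> carrier R"
      and r: "s \<in> regular_elements R" "s' \<in> regular_elements R"
        "t \<in> regular_elements R" "t' \<in> regular_elements R"
      and e: "a \<otimes> s' = a' \<otimes> s" "b \<otimes> t' = b' \<otimes> t"
      using 1 2 by (auto simp: frac_rel_def)
    note r' = r[THEN regular_elementsD(1)]
    have "(a \<otimes> t \<oplus> b \<otimes> s) \<otimes> (s' \<otimes> t')
        = (a \<otimes> s') \<otimes> (t \<otimes> t') \<oplus> (b \<otimes> t') \<otimes> (s \<otimes> s')"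
      using c r' by (simp add: m_ac l_distr r_distr)
    also have "\<dots> = (a' \<otimes> t' \<oplus> b' \<otimes> s') \<otimes> (s \<otimes> t)"
      unfolding e using c r' by (simp add: m_ac l_distr r_distr)
    finally show "fraction R (a \<otimes> t \<oplus> b \<otimes> s) (s \<otimes> t) = fraction R (a' \<otimes> t' \<oplus> b' \<otimes> s') (s' \<otimes> t')"
      using fraction_eq_iff c r r' by (simp add: mult_regular)
  qed
  from UN_equiv_class2[OF equiv_frac_rel equiv_frac_rel this, of "(a, s)" "(b, t)"]
  show ?thesis using assms by (simp add: total_quotient_ring_def fraction_def case_prod_unfold)
qed

lemma zero_total: "\<zero>\<^bsub>total_quotient_ring R\<^esub> = fraction R \<zero> \<one>"
  and one_total: "\<one>\<^bsub>total_quotient_ring R\<^esub> = fraction R \<one> \<one>"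
  by (simp_all add: total_quotient_ring_def)

theorem cring_total_quotient_ring: "cring (total_quotient_ring R)"
proof (rule cringI)
  let ?T = "total_quotient_ring R"
  note fr = fraction_closed fraction_eq_iff mult_fraction add_fraction zero_total one_total
    one_regular mult_regular regular_elementsD(1)
  show "abelian_group ?T"
  proof (rule abelian_groupI)
    show "\<exists>Y\<in>carrier ?T. Y \<oplus>\<^bsub>?T\<^esub> X = \<zero>\<^bsub>?T\<^esub>" if "X \<in> carrier ?T" for X
      using that
    proof (rule fraction_cases)
      fix a s assume as: "a \<in> carrier R" "s \<in> regular_elements R" "X = fraction R a s"
      have "fraction R (\<ominus> a) s \<oplus>\<^bsub>?T\<^esub> X = \<zero>\<^bsub>?T\<^esub>"
        using as by (simp add: fr l_minus l_neg)
      then show ?thesis using as by (metis fraction_closed a_inv_closed)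
    qed
  qed (auto elim!: fraction_cases simp: fr m_ac a_ac l_distr r_distr)
  show "comm_monoid ?T"
    by (rule comm_monoidI) (auto elim!: fraction_cases simp: fr m_ac)
  show "(X \<oplus>\<^bsub>?T\<^esub> Y) \<otimes>\<^bsub>?T\<^esub> Z = X \<otimes>\<^bsub>?T\<^esub> Z \<oplus>\<^bsub>?T\<^esub> Y \<otimes>\<^bsub>?T\<^esub> Z"
    if XYZ: "X \<in> carrier ?T" "Y \<in> carrier ?T" "Z \<in> carrier ?T" for X Y Z
  proof -
    obtain a s b t c u where
      ac: "a \<in> carrier R" "b \<in> carrier R" "c \<in> carrier R" "s \<in> regular_elements R"
        "t \<in> regular_elements R" "u \<in> regular_elements R"
      and eqs: "X = fraction R a s" "Y = fraction R b t" "Z = fraction R c u"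
      using XYZ by (auto elim!: fraction_cases)
    show ?thesis unfolding eqs using ac by (simp add: fr m_ac a_ac l_distr r_distr)
  qed
qed

end

end

theory Submission
  imports Defs
begin

text \<open>
  A finitely generated ideal of \<open>R[x]\<close> is dense iff it contains a regular element (McCoy), and the
  coefficients of the elements of an ideal form an ideal. Hence the maximal \<open>q\<close>-ideals of \<open>R[x]\<close> are
  the extensions \<open>p[x]\<close> of the maximal \<open>q\<close>-ideals \<open>p\<close> of \<open>R\<close>, and every prime of \<open>R[x]\<close> without regular
  elements, i.e. every prime of \<open>T(R[x])\<close>, lies in one of them. It remains to see that \<open>p\<close> and \<open>p[x]\<close>
  have the same height. Ideals saturated with respect to the complement of \<open>p\<close> are \<open>q\<close>-ideals, so the
  localization of \<open>R\<close> at \<open>p\<close> is noetherian; then Krull's principal ideal theorem in \<open>R[x]\<close> shows that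
  \<open>p'[x] \<subset> Q \<subset> p[x]\<close> forces a prime strictly between \<open>p'\<close> and \<open>p\<close>, and Kaplansky's argument for
  strong S-rings turns a chain of primes ending at \<open>p[x]\<close> into one of the same length ending at \<open>p\<close>.
  No localization is formed: saturated ideals stand for its ideals throughout.
\<close>

section \<open>Chain conditions and saturated ideals\<close>

text \<open>Over a general ring the height can grow from \<open>p\<close> to \<open>p[x]\<close>: a
  chain of primes of \<open>R[x]\<close> may contain two primes with the same contraction, and such
  a pair costs one step when the chain is contracted. The lower prime of the pair is then extended,
  so before the pair no step is missing; the loss has to be made good at the next extended prime.
  This repair needs a principal ideal theorem, and since that is applied in \<open>R[x]\<close>, the
  chain condition must first be carried there, hence the Hilbert basis theorem. The obstacle is that
  the hypothesis is a chain condition on \<open>q\<close>-ideals only; ideals of \<open>R\<close>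
  need not be finitely generated. The classical arguments with generators are therefore run with
  maximal members of families of saturated ideals, and an equation in the local ring becomes one in
  \<open>R\<close> after multiplication by some \<open>s\<close> outside \<open>p\<close>.\<close>

definition acc_on :: "'a set set \<Rightarrow> bool"
  where "acc_on C \<longleftrightarrow> (\<forall>I :: nat \<Rightarrow> 'a set. (\<forall>n. I n \<in> C) \<and> (\<forall>n. I n \<subseteq> I (Suc n)) \<longrightarrow>
    (\<exists>k. \<forall>n\<ge>k. I n = I k))"

lemma acc_onD:
  assumes "acc_on C" "\<And>n::nat. I n \<in> C" "\<And>n. I n \<subseteq> I (Suc n)"
  shows "\<exists>k. \<forall>n\<ge>k. I n = I k"
  using assms unfolding acc_on_def by blast

lemma acc_on_subset: "acc_on C \<Longrightarrow> D \<subseteq> C \<Longrightarrow> acc_on D"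
  unfolding acc_on_def by blast

lemma acc_on_wf:
  assumes "acc_on C"
  shows "wf {(J, I). I \<in> C \<and> J \<in> C \<and> I \<subset> J}"
  unfolding wf_iff_no_infinite_down_chain
proof
  assume "\<exists>f. \<forall>i. (f (Suc i), f i) \<in> {(J, I). I \<in> C \<and> J \<in> C \<and> I \<subset> J}"
  then obtain f :: "nat \<Rightarrow> 'a set"
    where f: "\<And>i. f i \<in> C" "\<And>i. f i \<subset> f (Suc i)" by blast
  have "\<And>i. f i \<subseteq> f (Suc i)" using f(2) by blast
  from acc_onD[where I = f, OF assms f(1) this] obtain k where "\<forall>n\<ge>k. f n = f k" by blast
  then have "f (Suc k) = f k" using le_SucI by blast
  then show False using f(2)[of k] by blast
qed

lemma acc_on_maximal:
  assumes "acc_on C" "A \<subseteq> C" "I \<in> A"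
  shows "\<exists>M\<in>A. I \<subseteq> M \<and> (\<forall>J\<in>A. M \<subseteq> J \<longrightarrow> J = M)"
proof -
  have "I \<in> {J \<in> A. I \<subseteq> J}" using assms(3) by simp
  then show ?thesis
  proof (rule wfE_min[OF acc_on_wf[OF assms(1)]])
    fix M assume M: "M \<in> {J \<in> A. I \<subseteq> J}"
      and max: "\<And>J. (J, M) \<in> {(J, I). I \<in> C \<and> J \<in> C \<and> I \<subset> J} \<Longrightarrow> J \<notin> {J \<in> A. I \<subseteq> J}"
    have "J = M" if "J \<in> A" "M \<subseteq> J" for J
    proof (rule ccontr)
      assume "J \<noteq> M"
      then show False using max[of J] that M assms(2) by auto
    qed
    with M show ?thesis by blast
  qed
qed

text \<open>For \<open>S\<close> multiplicatively closed these are the contractions of the ideals of \<open>S\<inverse>A\<close>.\<close>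

definition saturated :: "('a, 'r) ring_scheme \<Rightarrow> 'a set \<Rightarrow> 'a set \<Rightarrow> bool"
  where "saturated A S I \<longleftrightarrow>
    ideal I A \<and> (\<forall>s\<in>S. \<forall>x\<in>carrier A. s \<otimes>\<^bsub>A\<^esub> x \<in> I \<longrightarrow> x \<in> I)"

text \<open>The contraction of the extension of \<open>I\<close> to the localization at
  \<open>S\<close>.\<close>

definition saturation :: "('a, 'r) ring_scheme \<Rightarrow> 'a set \<Rightarrow> 'a set \<Rightarrow> 'a set"
  where "saturation A S I = {x \<in> carrier A. \<exists>s\<in>S. s \<otimes>\<^bsub>A\<^esub> x \<in> I}"

lemma saturated_mono: "saturated A S I \<Longrightarrow> T \<subseteq> S \<Longrightarrow> saturated A T I"
  unfolding saturated_def by blast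

lemma saturatedD:
  assumes "saturated A S I"
  shows "ideal I A" "\<And>s x. s \<in> S \<Longrightarrow> x \<in> carrier A \<Longrightarrow> s \<otimes>\<^bsub>A\<^esub> x \<in> I \<Longrightarrow> x \<in> I"
  using assms unfolding saturated_def by blast+

section \<open>Elementary facts on ideals, primes and saturations\<close>

lemma idealD:
  fixes A (structure)
  assumes "ideal I A"
  shows "I \<subseteq> carrier A" "\<And>x. x \<in> I \<Longrightarrow> x \<in> carrier A" "\<zero> \<in> I"
    "\<And>x y. x \<in> I \<Longrightarrow> y \<in> I \<Longrightarrow> x \<oplus> y \<in> I"
    "\<And>x y. x \<in> I \<Longrightarrow> y \<in> I \<Longrightarrow> x \<ominus> y \<in> I"
    "\<And>x. x \<in> I \<Longrightarrow> \<ominus> x \<in> I"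
    "\<And>r x. x \<in> I \<Longrightarrow> r \<in> carrier A \<Longrightarrow> r \<otimes> x \<in> I"
    "\<And>r x. x \<in> I \<Longrightarrow> r \<in> carrier A \<Longrightarrow> x \<otimes> r \<in> I"
proof -
  interpret ideal I A by fact
  show "I \<subseteq> carrier A" "\<And>x. x \<in> I \<Longrightarrow> x \<in> carrier A" "\<zero> \<in> I"
    "\<And>x y. x \<in> I \<Longrightarrow> y \<in> I \<Longrightarrow> x \<oplus> y \<in> I"
    "\<And>x. x \<in> I \<Longrightarrow> \<ominus> x \<in> I"
    "\<And>r x. x \<in> I \<Longrightarrow> r \<in> carrier A \<Longrightarrow> r \<otimes> x \<in> I"
    "\<And>r x. x \<in> I \<Longrightarrow> r \<in> carrier A \<Longrightarrow> x \<otimes> r \<in> I"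
    using a_subset by (auto intro: I_l_closed I_r_closed)
  then show "\<And>x y. x \<in> I \<Longrightarrow> y \<in> I \<Longrightarrow> x \<ominus> y \<in> I" by (simp add: minus_eq)
qed

lemma primeD:
  fixes A (structure)
  assumes "primeideal p A"
  shows "ideal p A" "\<one> \<in> carrier A - p"
    "\<And>a b. a \<in> carrier A \<Longrightarrow> b \<in> carrier A \<Longrightarrow> a \<otimes> b \<in> p \<Longrightarrow> a \<in> p \<or> b \<in> p"
    "\<And>a b. a \<in> carrier A - p \<Longrightarrow> b \<in> carrier A - p \<Longrightarrow> a \<otimes> b \<in> carrier A - p"
    "p \<subset> carrier A"
proof -
  interpret primeideal p A by fact
  show "ideal p A" by (rule ideal_axioms)
  show *: "\<And>a b. a \<in> carrier A \<Longrightarrow> b \<in> carrier A \<Longrightarrow> a \<otimes> b \<in> p \<Longrightarrow> a \<in> p \<or> b \<in> p"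
    by (rule I_prime)
  show "\<one> \<in> carrier A - p" using one_imp_carrier I_notcarr by auto
  show "\<And>a b. a \<in> carrier A - p \<Longrightarrow> b \<in> carrier A - p \<Longrightarrow> a \<otimes> b \<in> carrier A - p"
    using * by auto
  show "p \<subset> carrier A" using I_notcarr a_subset by auto
qed

context cring
begin

lemma ideal_cringI:
  assumes "I \<subseteq> carrier R" "\<zero> \<in> I" "\<And>x y. x \<in> I \<Longrightarrow> y \<in> I \<Longrightarrow> x \<oplus> y \<in> I"
    "\<And>r x. x \<in> I \<Longrightarrow> r \<in> carrier R \<Longrightarrow> r \<otimes> x \<in> I"
  shows "ideal I R"
proof (rule idealI)
  show "ring R" by (rule ring_axioms)
  show "subgroup I (add_monoid R)"
  proof
    fix x assume x: "x \<in> I"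
    then have "\<ominus> x = (\<ominus> \<one>) \<otimes> x" using assms(1) by (auto simp: l_minus)
    then show "inv\<^bsub>add_monoid R\<^esub> x \<in> I"
      using assms(4)[OF x, of "\<ominus> \<one>"] by (simp add: a_inv_def)
  qed (use assms in auto)
  show "\<And>a x. a \<in> I \<Longrightarrow> x \<in> carrier R \<Longrightarrow> x \<otimes> a \<in> I" by (rule assms(4))
  show "\<And>a x. a \<in> I \<Longrightarrow> x \<in> carrier R \<Longrightarrow> a \<otimes> x \<in> I"
    using assms(1,4) by (metis m_comm subset_iff)
qed

lemma primeideal_cringI:
  assumes "ideal I R" "\<one> \<notin> I"
    "\<And>a b. a \<in> carrier R \<Longrightarrow> b \<in> carrier R \<Longrightarrow> a \<otimes> b \<in> I \<Longrightarrow> a \<in> I \<or> b \<in> I"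
  shows "primeideal I R"
  using assms cring_axioms by (intro primeidealI) auto

lemma prime_mult_iff:
  assumes "primeideal p R" "a \<in> carrier R" "b \<in> carrier R"
  shows "a \<otimes> b \<in> p \<longleftrightarrow> a \<in> p \<or> b \<in> p"
  using primeD(1,3)[OF assms(1)] assms(2,3) idealD(7,8) by metis

definition add_mults :: "'a set \<Rightarrow> 'a \<Rightarrow> 'a set"
  where "add_mults I b = {x. \<exists>i\<in>I. \<exists>r\<in>carrier R. x = i \<oplus> r \<otimes> b}"

lemma add_multsI: "i \<in> I \<Longrightarrow> r \<in> carrier R \<Longrightarrow> i \<oplus> r \<otimes> b \<in> add_mults I b"
  unfolding add_mults_def by blast

lemma ideal_add_mults:
  assumes "ideal I R" "b \<in> carrier R"
  shows "ideal (add_mults I b) R" "I \<subseteq> add_mults I b" "b \<in> add_mults I b"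
proof -
  note I = idealD[OF assms(1)]
  show "ideal (add_mults I b) R"
  proof (rule ideal_cringI)
    show "add_mults I b \<subseteq> carrier R" unfolding add_mults_def using I assms(2) by auto
    show "\<zero> \<in> add_mults I b" using add_multsI[of \<zero> I \<zero> b] I assms(2) by simp
  next
    fix x y assume "x \<in> add_mults I b" "y \<in> add_mults I b"
    then obtain i r j t where *: "i \<in> I" "r \<in> carrier R" "x = i \<oplus> r \<otimes> b"
      "j \<in> I" "t \<in> carrier R" "y = j \<oplus> t \<otimes> b" unfolding add_mults_def by blast
    then have "x \<oplus> y = (i \<oplus> j) \<oplus> (r \<oplus> t) \<otimes> b" using I(2) assms(2) by (simp add: l_distr a_ac)
    then show "x \<oplus> y \<in> add_mults I b" using add_multsI[of "i \<oplus> j" I "r \<oplus> t" b] * I by simp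
  next
    fix t x assume "x \<in> add_mults I b" and t: "t \<in> carrier R"
    then obtain i r where *: "i \<in> I" "r \<in> carrier R" "x = i \<oplus> r \<otimes> b"
      unfolding add_mults_def by blast
    then have "t \<otimes> x = t \<otimes> i \<oplus> (t \<otimes> r) \<otimes> b" using I(2) assms(2) t by (simp add: r_distr m_assoc)
    then show "t \<otimes> x \<in> add_mults I b" using add_multsI[of "t \<otimes> i" I "t \<otimes> r" b] * I t by simp
  qed
  show "I \<subseteq> add_mults I b"
  proof
    fix x assume "x \<in> I"
    then show "x \<in> add_mults I b" using add_multsI[of x I \<zero> b] I assms(2) by simp
  qed
  show "b \<in> add_mults I b" using add_multsI[of \<zero> I \<one> b] I assms(2) by simp
qed

lemma ideal_sum:
  assumes "ideal I R" "ideal J R"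
  shows "ideal (I <+> J) R" "I \<subseteq> I <+> J" "J \<subseteq> I <+> J"
    "\<And>x. x \<in> I <+> J \<longleftrightarrow> (\<exists>i\<in>I. \<exists>j\<in>J. x = i \<oplus> j)"
proof -
  show *: "\<And>x. x \<in> I <+> J \<longleftrightarrow> (\<exists>i\<in>I. \<exists>j\<in>J. x = i \<oplus> j)"
    by (auto simp: set_add_def')
  show "ideal (I <+> J) R" by (rule add_ideals[OF assms])
  show "I \<subseteq> I <+> J"
  proof
    fix x assume "x \<in> I"
    then have "x = x \<oplus> \<zero>" using idealD(2)[OF assms(1)] by simp
    then show "x \<in> I <+> J" unfolding * using \<open>x \<in> I\<close> idealD(3)[OF assms(2)] by blast
  qed
  show "J \<subseteq> I <+> J"
  proof
    fix x assume "x \<in> J"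
    then have "x = \<zero> \<oplus> x" using idealD(2)[OF assms(2)] by simp
    then show "x \<in> I <+> J" unfolding * using \<open>x \<in> J\<close> idealD(3)[OF assms(1)] by blast
  qed
qed

lemma saturation_prime:
  assumes p: "primeideal p R" and I: "ideal I R"
  shows "saturated R (carrier R - p) (saturation R (carrier R - p) I)"
    and "I \<subseteq> saturation R (carrier R - p) I"
proof -
  note I = idealD[OF I]
  let ?S = "carrier R - p"
  let ?T = "saturation R ?S I"
  note S = primeD(2,4)[OF p]
  show "I \<subseteq> ?T"
  proof
    fix x assume "x \<in> I"
    then have "x \<in> carrier R" "\<one> \<otimes> x \<in> I" using I by auto
    then show "x \<in> ?T" unfolding saturation_def using S(1) by blast
  qed
  have "ideal ?T R"
  proof (rule ideal_cringI)
    show "?T \<subseteq> carrier R" unfolding saturation_def by blast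
    show "\<zero> \<in> ?T" using \<open>I \<subseteq> ?T\<close> I by blast
  next
    fix x y assume "x \<in> ?T" "y \<in> ?T"
    then obtain s t where *: "s \<in> ?S" "t \<in> ?S" "s \<otimes> x \<in> I" "t \<otimes> y \<in> I" "x \<in> carrier R" "y \<in> carrier R"
      unfolding saturation_def by blast
    then have "(s \<otimes> t) \<otimes> (x \<oplus> y) = t \<otimes> (s \<otimes> x) \<oplus> s \<otimes> (t \<otimes> y)"
      by (simp add: m_ac r_distr)
    then have "(s \<otimes> t) \<otimes> (x \<oplus> y) \<in> I" using * I by simp
    then show "x \<oplus> y \<in> ?T" unfolding saturation_def using S(2)[OF *(1,2)] * by blast
  next
    fix r x assume "x \<in> ?T" and r: "r \<in> carrier R"
    then obtain s where *: "s \<in> ?S" "s \<otimes> x \<in> I" "x \<in> carrier R" unfolding saturation_def by blast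
    then have "s \<otimes> (r \<otimes> x) = r \<otimes> (s \<otimes> x)" using r by (simp add: m_ac)
    then have "s \<otimes> (r \<otimes> x) \<in> I" using * r I by simp
    then show "r \<otimes> x \<in> ?T" unfolding saturation_def using * r by blast
  qed
  moreover have "x \<in> ?T" if st: "s \<in> ?S" "x \<in> carrier R" "s \<otimes> x \<in> ?T" for s x
  proof -
    obtain t where t: "t \<in> ?S" "t \<otimes> (s \<otimes> x) \<in> I" using st(3) unfolding saturation_def by blast
    then have "(t \<otimes> s) \<otimes> x \<in> I" using st by (simp add: m_assoc)
    then show ?thesis unfolding saturation_def using S(2)[OF t(1) st(1)] st(2) by blast
  qed
  ultimately show "saturated R ?S ?T" unfolding saturated_def by blast
qed

lemma saturated_prime:
  assumes "primeideal q R" "q \<subseteq> p"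
  shows "saturated R (carrier R - p) q"
proof -
  have "x \<in> q" if "s \<in> carrier R - p" "x \<in> carrier R" "s \<otimes> x \<in> q" for s x
    using primeD(3)[OF assms(1), of s x] that assms(2) by auto
  then show ?thesis using primeD(1)[OF assms(1)] unfolding saturated_def by auto
qed

lemma saturation_least:
  assumes "saturated R S J" "I \<subseteq> J" "x \<in> saturation R S I"
  shows "x \<in> J"
  using assms unfolding saturated_def saturation_def by blast

text \<open>\<open>p\<close> plays the maximal ideal of a local ring: an element outside
  \<open>p\<close> acts as a unit, so a saturated ideal containing one contains
  \<open>\<one>\<close>.\<close>

lemma saturated_proper:
  assumes "primeideal p R" "saturated R (carrier R - p) I" "I \<noteq> carrier R"
  shows "I \<subseteq> p"
proof
  fix x assume x: "x \<in> I"
  note I = idealD[OF saturatedD(1)[OF assms(2)]]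
  show "x \<in> p"
  proof (rule ccontr)
    assume "x \<notin> p"
    then have "x \<in> carrier R - p" "x \<otimes> \<one> \<in> I" using x I by auto
    then have "\<one> \<in> I" using saturatedD(2)[OF assms(2), of x \<one>] by auto
    then have "I = carrier R" using I(1) I(7)[of \<one>] by force
    with assms(3) show False by blast
  qed
qed

end

section \<open>A localized principal ideal theorem\<close>

context cring
begin

text \<open>The colon ideals \<open>C b\<close> of \<open>I\<close> with \<open>b\<close> outside
  \<open>I\<close> are saturated, so one of them is maximal. It is prime: if
  \<open>u \<otimes> v\<close> is in \<open>C b\<close> and \<open>v\<close> is not, then
  \<open>C (v \<otimes> b)\<close> contains \<open>C b\<close>, hence equals it, and it contains
  \<open>u\<close>.\<close>

lemma associated_prime:
  assumes p: "primeideal p R" and acc: "acc_on {I. saturated R (carrier R - p) I}"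
    and I: "saturated R (carrier R - p) I" "I \<noteq> carrier R"
  obtains b where "b \<in> carrier R - I" "primeideal {r \<in> carrier R. r \<otimes> b \<in> I} R"
    "{r \<in> carrier R. r \<otimes> b \<in> I} \<subseteq> p"
proof -
  note iI = idealD[OF saturatedD(1)[OF I(1)]]
  define C where "C b = {r \<in> carrier R. r \<otimes> b \<in> I}" for b
  have C_ideal: "ideal (C b) R" if "b \<in> carrier R" for b
  proof (rule ideal_cringI)
    show "x \<oplus> y \<in> C b" if "x \<in> C b" "y \<in> C b" for x y
      using that \<open>b \<in> carrier R\<close> iI unfolding C_def by (simp add: l_distr)
    show "r \<otimes> x \<in> C b" if "x \<in> C b" "r \<in> carrier R" for x r
      using that \<open>b \<in> carrier R\<close> iI unfolding C_def by (simp add: m_assoc)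
  qed (use that iI in \<open>auto simp: C_def\<close>)
  have C_sat: "saturated R (carrier R - p) (C b)" if "b \<in> carrier R" for b
  proof -
    have "x \<in> C b" if sx: "s \<in> carrier R - p" "x \<in> carrier R" "s \<otimes> x \<in> C b" for s x
    proof -
      have "s \<otimes> (x \<otimes> b) \<in> I" using sx \<open>b \<in> carrier R\<close> unfolding C_def by (simp add: m_assoc)
      then show ?thesis using saturatedD(2)[OF I(1) sx(1)] sx(2) \<open>b \<in> carrier R\<close>
        unfolding C_def by simp
    qed
    then show ?thesis using C_ideal[OF that] unfolding saturated_def by blast
  qed
  obtain x where x: "x \<in> carrier R - I" using I(2) iI(1) by blast
  have "C ` (carrier R - I) \<subseteq> {I. saturated R (carrier R - p) I}" using C_sat by blast
  from acc_on_maximal[OF acc this imageI[OF x]]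
  obtain M where M: "M \<in> C ` (carrier R - I)"
    and max: "\<forall>J\<in>C ` (carrier R - I). M \<subseteq> J \<longrightarrow> J = M"
    by (elim bexE conjE)
  then obtain b where b: "b \<in> carrier R - I" "M = C b" by blast
  have "primeideal (C b) R"
  proof (rule primeideal_cringI)
    show "ideal (C b) R" using C_ideal b by blast
    show "\<one> \<notin> C b" using b unfolding C_def by simp
  next
    fix u v assume uv: "u \<in> carrier R" "v \<in> carrier R" "u \<otimes> v \<in> C b"
    show "u \<in> C b \<or> v \<in> C b"
    proof (rule disjCI)
      assume "v \<notin> C b"
      then have vb: "v \<otimes> b \<in> carrier R - I" using uv b unfolding C_def by simp
      have "C b \<subseteq> C (v \<otimes> b)"
      proof
        fix r assume "r \<in> C b"
        then have "v \<otimes> (r \<otimes> b) \<in> I" "r \<in> carrier R" using iI uv unfolding C_def by auto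
        then show "r \<in> C (v \<otimes> b)" using uv b unfolding C_def by (simp add: m_lcomm)
      qed
      then have "C (v \<otimes> b) = C b" using max vb b(2) by simp
      moreover have "u \<in> C (v \<otimes> b)" using uv b unfolding C_def by (simp add: m_assoc)
      ultimately show "u \<in> C b" by blast
    qed
  qed
  moreover have "C b \<subseteq> p"
    using saturated_proper[OF p C_sat[of b]] b primeD(5)[OF \<open>primeideal (C b) R\<close>] by blast
  ultimately show thesis using that b(1) unfolding C_def by blast
qed

text \<open>Nakayama's lemma without generators: a maximal saturated proper submodule of \<open>M\<close>
  containing \<open>N\<close> contains \<open>c \<cdot> M\<close>.\<close>

lemma nakayama_saturated:
  assumes p: "primeideal p R" and acc: "acc_on {I. saturated R (carrier R - p) I}"
    and M: "saturated R (carrier R - p) M" and N: "saturated R (carrier R - p) N" "N \<subseteq> M"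
    and c: "c \<in> p"
    and gen: "\<And>m. m \<in> M \<Longrightarrow> \<exists>s\<in>carrier R - p. \<exists>n\<in>N. \<exists>m'\<in>M. s \<otimes> m = n \<oplus> c \<otimes> m'"
  shows "N = M"
proof (rule ccontr)
  assume "N \<noteq> M"
  let ?S = "carrier R - p"
  let ?A = "{I. saturated R ?S I \<and> I \<subset> M}"
  note iM = idealD[OF saturatedD(1)[OF M]]
  note ip = idealD[OF primeD(1)[OF p]]
  have A: "?A \<subseteq> {I. saturated R ?S I}" "N \<in> ?A" using N \<open>N \<noteq> M\<close> by auto
  from acc_on_maximal[OF acc A]
  obtain K where K: "K \<in> ?A" "N \<subseteq> K" and max: "\<forall>J\<in>?A. K \<subseteq> J \<longrightarrow> J = K"
    by (elim bexE conjE)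
  have Ks: "saturated R ?S K" "K \<subset> M" using K by auto
  note iK = idealD[OF saturatedD(1)[OF Ks(1)]]
  \<comment> \<open>Otherwise maximality of \<open>K\<close> forces \<open>?L = M\<close>, so
    \<open>s \<otimes> m = i \<oplus> r \<otimes> (c \<otimes> m)\<close>. As \<open>c\<close> is in
    \<open>p\<close>, \<open>s \<ominus> r \<otimes> c\<close> is outside \<open>p\<close> and moves
    \<open>m\<close> into \<open>K\<close>, so \<open>m\<close> is in \<open>K\<close> after
    all.\<close>
  have cm: "c \<otimes> m \<in> K" if m: "m \<in> M" for m
  proof (rule ccontr)
    assume n: "c \<otimes> m \<notin> K"
    have cc: "c \<in> carrier R" "m \<in> carrier R" "c \<otimes> m \<in> carrier R" using ip(2)[OF c] iM(2)[OF m] by simp_all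
    let ?L = "saturation R ?S (add_mults K (c \<otimes> m))"
    note aK = ideal_add_mults[OF saturatedD(1)[OF Ks(1)] cc(3)]
    note sL = saturation_prime[OF p aK(1)]
    have "add_mults K (c \<otimes> m) \<subseteq> M"
    proof
      fix x assume "x \<in> add_mults K (c \<otimes> m)"
      then obtain i r where "i \<in> K" "r \<in> carrier R" "x = i \<oplus> r \<otimes> (c \<otimes> m)"
        unfolding add_mults_def by blast
      then show "x \<in> M" using Ks(2) iM(4,7) m cc by auto
    qed
    then have "?L \<subseteq> M" using saturation_least[OF M] by blast
    moreover have "K \<subset> ?L" using aK(2,3) sL(2) n by blast
    ultimately have "?L = M" using max sL(1) by auto
    then have "m \<in> ?L" using m by blast
    then obtain s i r where s: "s \<in> ?S" "i \<in> K" "r \<in> carrier R" "s \<otimes> m = i \<oplus> r \<otimes> (c \<otimes> m)"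
      unfolding saturation_def add_mults_def by blast
    have carr: "s \<in> carrier R" "i \<in> carrier R" using s iK(2) by auto
    have "(s \<ominus> r \<otimes> c) \<otimes> m = s \<otimes> m \<ominus> r \<otimes> (c \<otimes> m)"
      using carr s(3) cc by (simp add: minus_eq l_distr l_minus m_assoc)
    also have "\<dots> = i" unfolding s(4) using carr s(3) cc by (simp add: minus_eq a_assoc r_neg)
    finally have "(s \<ominus> r \<otimes> c) \<otimes> m \<in> K" using s by simp
    moreover have "s \<ominus> r \<otimes> c \<notin> p"
    proof
      assume "s \<ominus> r \<otimes> c \<in> p"
      then have "(s \<ominus> r \<otimes> c) \<oplus> r \<otimes> c \<in> p" using c s(3) by (intro ip(4,7))
      moreover have "(s \<ominus> r \<otimes> c) \<oplus> r \<otimes> c = s"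
        using carr s(3) cc by (simp add: minus_eq a_assoc l_neg)
      ultimately show False using s by simp
    qed
    ultimately have "m \<in> K" using saturatedD(2)[OF Ks(1), of "s \<ominus> r \<otimes> c" m] carr s cc by simp
    then show False using n iK(7) cc by simp
  qed
  have "M \<subseteq> K"
  proof
    fix m assume m: "m \<in> M"
    then obtain s n m' where s: "s \<in> ?S" "n \<in> N" "m' \<in> M" "s \<otimes> m = n \<oplus> c \<otimes> m'"
      using gen by blast
    then have "s \<otimes> m \<in> K" using cm[of m'] iK(4,7) K(2) by auto
    then show "m \<in> K" using saturatedD(2)[OF Ks(1)] s(1) m iM(2) by blast
  qed
  then show False using Ks(2) by blast
qed

text \<open>The descending chain condition at \<open>p\<close> modulo \<open>Z\<close>, by noetherian induction on \<open>I\<close>: by minimality of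
  \<open>p\<close>, \<open>I\<close> can be enlarged by an element whose annihilator modulo \<open>I\<close> is exactly \<open>p\<close>.\<close>

lemma dcc_saturated:
  assumes p: "primeideal p R" and acc: "acc_on {I. saturated R (carrier R - p) I}"
    and min: "\<And>q'. primeideal q' R \<Longrightarrow> Z \<subseteq> q' \<Longrightarrow> q' \<subseteq> p \<Longrightarrow> q' = p"
    and X: "\<And>n::nat. saturated R (carrier R - p) (X n)" "\<And>n. X (Suc n) \<subseteq> X n"
    and I: "saturated R (carrier R - p) I" "Z \<subseteq> I"
  shows "\<exists>n. \<forall>m\<ge>n. X n \<subseteq> saturation R (carrier R - p) (X m <+> I)"
proof -
  let ?S = "carrier R - p"
  note S = primeD(2,4)[OF p]
  note ip = idealD[OF primeD(1)[OF p]]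
  have Xanti: "X m \<subseteq> X n" if "n \<le> m" for n m using that X(2) by (rule lift_Suc_antimono_le[rotated])
  have Xi: "ideal (X n) R" for n using X(1) saturatedD(1) by blast
  show ?thesis using I
  proof (induction I rule: wf_induct_rule[OF acc_on_wf[OF acc]])
    case (1 I)
    note I = 1(2,3)
    have iI': "ideal I R" using I saturatedD(1) by blast
    note iI = idealD[OF iI']
    show ?case
    proof (cases "I = carrier R")
      case True
      have "X 0 \<subseteq> saturation R ?S (X m <+> I)" for m
        using ideal_sum(3)[OF Xi[of m] iI'] saturation_prime(2)[OF p ideal_sum(1)[OF Xi[of m] iI']]
          idealD(1)[OF Xi[of 0]] True by blast
      then show ?thesis by blast
    next
      case False
      obtain b where b: "b \<in> carrier R - I" "primeideal {r \<in> carrier R. r \<otimes> b \<in> I} R"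
        "{r \<in> carrier R. r \<otimes> b \<in> I} \<subseteq> p"
        using associated_prime[OF p acc I(1) False] .
      have "Z \<subseteq> {r \<in> carrier R. r \<otimes> b \<in> I}" using I(2) b(1) iI(2,8) by auto
      \<comment> \<open>Up to saturation, \<open>J\<close> below is thus one step of length one
        above \<open>I\<close>: modulo \<open>I\<close> it is generated by \<open>b\<close>, whose
        annihilator is \<open>p\<close>.\<close>
      from min[OF b(2) this b(3)] have pb: "\<And>r. r \<in> carrier R \<Longrightarrow> r \<otimes> b \<in> I \<longleftrightarrow> r \<in> p" by blast
      have bc: "b \<in> carrier R" using b(1) by blast
      note aI = ideal_add_mults[OF iI' bc]
      define J where "J = saturation R ?S (add_mults I b)"
      have J: "saturated R ?S J" "add_mults I b \<subseteq> J"
        using saturation_prime[OF p aI(1)] unfolding J_def by blast+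
      have "I \<subset> J" using J(2) aI b(1) by blast
      then obtain n where n: "\<And>m. m \<ge> n \<Longrightarrow> X n \<subseteq> saturation R ?S (X m <+> J)"
        using 1(1)[of J] J(1) I by blast
      have memJ: "\<exists>s\<in>?S. \<exists>i\<in>I. \<exists>r\<in>carrier R. s \<otimes> x = i \<oplus> r \<otimes> b" if "x \<in> J" for x
        using that unfolding J_def saturation_def add_mults_def by blast
      note iJ = idealD[OF saturatedD(1)[OF J(1)]]
      show ?thesis
      \<comment> \<open>Either every \<open>X m\<close> meets \<open>J\<close> outside
        \<open>I\<close>; then the saturation of \<open>X m <+> I\<close> swallows all of
        \<open>J\<close>, and the bound \<open>n\<close> obtained for \<open>J\<close> serves for
        \<open>I\<close>. Or some \<open>X k\<close> meets \<open>J\<close> only inside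
        \<open>I\<close>; then, beyond \<open>k\<close>, the modular law lets \<open>I\<close>
        replace \<open>J\<close>.\<close>
      proof (cases "\<forall>m. \<not> X m \<inter> J \<subseteq> I")
        case True
        have "X n \<subseteq> saturation R ?S (X m <+> I)" if m: "m \<ge> n" for m
        proof
          fix x assume x: "x \<in> X n"
          note sumI = ideal_sum[OF Xi[of m] iI']
          define T where "T = saturation R ?S (X m <+> I)"
          have T: "saturated R ?S T" "X m <+> I \<subseteq> T"
            using saturation_prime[OF p sumI(1)] unfolding T_def by blast+
          note iT = idealD[OF saturatedD(1)[OF T(1)]]
          have IT: "I \<subseteq> T" and XT: "X m \<subseteq> T" using sumI(2,3) T(2) by blast+
          obtain w where w: "w \<in> X m" "w \<in> J" "w \<notin> I" using True by blast
          obtain s i r where s: "s \<in> ?S" "i \<in> I" "r \<in> carrier R" "s \<otimes> w = i \<oplus> r \<otimes> b"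
            using memJ[OF w(2)] by blast
          have wc: "w \<in> carrier R" by (rule iJ(2)) (rule w(2))
          \<comment> \<open>Hence \<open>r\<close> can be cancelled at \<open>p\<close>, and
            \<open>b\<close> lies in \<open>T\<close> because \<open>r \<otimes> b\<close>
            does.\<close>
          have "r \<notin> p"
          proof
            assume "r \<in> p"
            then have "s \<otimes> w \<in> I" using pb s iI by simp
            then show False using saturatedD(2)[OF I(1) s(1) wc] w by blast
          qed
          moreover have "r \<otimes> b = s \<otimes> w \<ominus> i"
            unfolding s(4) using s iI bc by (simp add: minus_eq a_assoc[symmetric] a_comm[of i] )
              (simp add: a_assoc r_neg)
          moreover have "s \<otimes> w \<ominus> i \<in> T" using XT IT w s by (intro iT(5,7)) auto
          ultimately have bT: "b \<in> T" using saturatedD(2)[OF T(1), of r b] s bc by simp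
          have "X n \<subseteq> saturation R ?S (X m <+> J)" using n m by blast
          then obtain t where t: "t \<in> ?S" "t \<otimes> x \<in> X m <+> J" using x unfolding saturation_def by blast
          then obtain z j where z: "z \<in> X m" "j \<in> J" "t \<otimes> x = z \<oplus> j"
            using ideal_sum(4)[OF Xi[of m] saturatedD(1)[OF J(1)]] by blast
          have "J \<subseteq> T"
          proof
            fix y assume "y \<in> J"
            then obtain s i r where s: "s \<in> ?S" "i \<in> I" "r \<in> carrier R" "s \<otimes> y = i \<oplus> r \<otimes> b"
              using memJ by blast
            then have "s \<otimes> y \<in> T" using IT bT iT(4)[of i "r \<otimes> b"] iT(7)[of b r] by auto
            then show "y \<in> T" using saturatedD(2)[OF T(1) s(1)] iJ(2)[OF \<open>y \<in> J\<close>] by simp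
          qed
          then have "t \<otimes> x \<in> T" using z(3) iT(4)[of z j] z(1,2) XT by auto
          then show "x \<in> T" using saturatedD(2)[OF T(1) t(1)] idealD(2)[OF Xi x] by simp
        qed
        then show ?thesis by blast
      next
        case False
        then obtain k where k: "X k \<inter> J \<subseteq> I" by blast
        define n' where "n' = max n k"
        have "X n' \<subseteq> saturation R ?S (X m <+> I)" if m: "m \<ge> n'" for m
        proof
          fix x assume x: "x \<in> X n'"
          have "X n' \<subseteq> X n" "X n' \<subseteq> X k" "X m \<subseteq> X n'"
            unfolding n'_def using Xanti m n'_def by auto
          then obtain t where t: "t \<in> ?S" "t \<otimes> x \<in> X m <+> J"
            using x n[of m] m n'_def unfolding saturation_def by auto
          then obtain z j where z: "z \<in> X m" "j \<in> J" "t \<otimes> x = z \<oplus> j"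
            using ideal_sum(4)[OF Xi[of m] saturatedD(1)[OF J(1)]] by blast
          have zc: "z \<in> carrier R" "j \<in> carrier R" using idealD(2)[OF Xi z(1)] iJ(2)[OF z(2)] by simp_all
          have "j = t \<otimes> x \<ominus> z" unfolding z(3) using zc
            by (simp add: minus_eq a_comm[of z] a_assoc r_neg)
          moreover have "t \<otimes> x \<ominus> z \<in> X n'"
            using t(1) x z(1) \<open>X m \<subseteq> X n'\<close> by (intro idealD(5,7)[OF Xi[of n']]) auto
          ultimately have "j \<in> I" using k z(2) \<open>X n' \<subseteq> X k\<close> by blast
          then have "t \<otimes> x \<in> X m <+> I" using ideal_sum(4)[OF Xi[of m] iI'] z by blast
          then show "x \<in> saturation R ?S (X m <+> I)"
            using t(1) idealD(2)[OF Xi x] unfolding saturation_def by blast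
        qed
        then show ?thesis by blast
      qed
    qed
  qed
qed

text \<open>With \<open>y \<in> q\<close> outside \<open>q0\<close>, the \<open>q\<close>-saturations \<open>Y n\<close> of \<open>q0 + (y\<^sup>n)\<close> replace the symbolic powers
  of the usual argument. They become stationary modulo \<open>c\<close>, hence stationary by Nakayama's lemma,
  which is impossible since \<open>y\<close> is not invertible at \<open>q\<close>.\<close>

theorem principal_ideal_theorem:
  assumes p: "primeideal p R" and acc: "acc_on {I. saturated R (carrier R - p) I}"
    and q0: "primeideal q0 R" and q: "primeideal q R" and less: "q0 \<subset> q" "q \<subset> p" and c: "c \<in> p"
  obtains q' where "primeideal q' R" "q0 \<subseteq> q'" "c \<in> q'" "q' \<subset> p"
proof (rule ccontr)
  assume "\<not> thesis"
  with that have none: "\<And>q'. primeideal q' R \<Longrightarrow> q0 \<subseteq> q' \<Longrightarrow> c \<in> q' \<Longrightarrow> q' \<subset> p \<Longrightarrow> False" by blast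
  then have cq: "c \<notin> q" using q less by blast
  let ?S = "carrier R - p"
  let ?U = "carrier R - q"
  note U = primeD(2,4)[OF q]
  note iq0 = idealD[OF primeD(1)[OF q0]] and iq = idealD[OF primeD(1)[OF q]]
    and ip = idealD[OF primeD(1)[OF p]]
  have cc: "c \<in> carrier R" by (rule ip(2)) (rule c)
  obtain y where y: "y \<in> q" "y \<notin> q0" using less by blast
  have yc: "y \<in> carrier R" by (rule iq(2)) (rule y)
  define Y where "Y n = saturation R ?U (add_mults q0 (y [^] n))" for n :: nat
  have aY: "ideal (add_mults q0 (y [^] n)) R" "q0 \<subseteq> add_mults q0 (y [^] n)"
    "y [^] n \<in> add_mults q0 (y [^] n)" for n :: nat
    using ideal_add_mults[OF primeD(1)[OF q0]] yc by simp_all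
  have Yq: "saturated R ?U (Y n)" "add_mults q0 (y [^] n) \<subseteq> Y n" for n
    using saturation_prime[OF q aY(1)] unfolding Y_def by blast+
  \<comment> \<open>Since \<open>q\<close> is smaller than \<open>p\<close>, the
    \<open>q\<close>-saturated ideals are among the \<open>p\<close>-saturated ones, to which the
    chain condition applies.\<close>
  have Yp: "saturated R ?S (Y n)" for n
    using saturated_mono[OF Yq(1)] less by blast
  have Yi: "ideal (Y n) R" for n using Yq(1) saturatedD(1) by blast
  have Ydec: "Y (Suc n) \<subseteq> Y n" for n
  proof -
    have "add_mults q0 (y [^] Suc n) \<subseteq> Y n"
    proof
      fix x assume "x \<in> add_mults q0 (y [^] Suc n)"
      then obtain z r where zr: "z \<in> q0" "r \<in> carrier R" "x = z \<oplus> r \<otimes> (y [^] Suc n)"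
        unfolding add_mults_def by blast
      then have "x = z \<oplus> (r \<otimes> y) \<otimes> y [^] n" using yc by (simp add: m_ac)
      then have "x \<in> add_mults q0 (y [^] n)" using add_multsI[OF zr(1)] zr yc by simp
      then show "x \<in> Y n" using Yq(2) by blast
    qed
    then show ?thesis using saturation_least[OF Yq(1)[of n]] unfolding Y_def[of "Suc n"] by blast
  qed
  let ?Z = "add_mults q0 c"
  note a0 = ideal_add_mults[OF primeD(1)[OF q0] cc]
  define I where "I = saturation R ?S ?Z"
  have I: "saturated R ?S I" "?Z \<subseteq> I" using saturation_prime[OF p a0(1)] unfolding I_def by blast+
  \<comment> \<open>The negated claim says that \<open>p\<close> is minimal over \<open>q0\<close>
    and \<open>c\<close>, as \<open>dcc_saturated\<close> requires.\<close>
  have min: "q' = p" if "primeideal q' R" "?Z \<subseteq> q'" "q' \<subseteq> p" for q'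
    using none[OF that(1)] that(2,3) a0(2,3) by auto
  have "\<exists>n. \<forall>m\<ge>n. Y n \<subseteq> saturation R ?S (Y m <+> I)"
    by (rule dcc_saturated[where Z = ?Z and X = Y, OF p acc min Yp Ydec I])
  then
  obtain n where n: "Y n \<subseteq> saturation R ?S (Y (Suc n) <+> I)" using le_SucI by blast
  have "Y (Suc n) = Y n"
  \<comment> \<open>An element of \<open>Y n\<close> is, up to a factor outside \<open>p\<close>, an
    element of \<open>Y (Suc n)\<close> plus \<open>c \<otimes> r\<close>. Then
    \<open>c \<otimes> r\<close> is in \<open>Y n\<close>; since \<open>c\<close> is outside
    \<open>q\<close> and \<open>Y n\<close> is \<open>q\<close>-saturated, \<open>r\<close> itself
    is in \<open>Y n\<close>.\<close>
  proof (rule nakayama_saturated[OF p acc Yp[of n] Yp[of "Suc n"] Ydec c])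
    fix m assume m: "m \<in> Y n"
    then obtain s where s: "s \<in> ?S" "s \<otimes> m \<in> Y (Suc n) <+> I" using n unfolding saturation_def by blast
    then obtain z i where z: "z \<in> Y (Suc n)" "i \<in> I" "s \<otimes> m = z \<oplus> i"
      using ideal_sum(4)[OF Yi saturatedD(1)[OF I(1)]] by blast
    obtain t w r where t: "t \<in> ?S" "w \<in> q0" "r \<in> carrier R" "t \<otimes> i = w \<oplus> r \<otimes> c"
      using z(2) unfolding I_def saturation_def add_mults_def by blast
    have carr: "s \<in> carrier R" "m \<in> carrier R" "z \<in> carrier R" "t \<in> carrier R" "w \<in> carrier R"
      "i \<in> carrier R"
      using s(1) t(1) idealD(2)[OF Yi m] idealD(2)[OF Yi z(1)] iq0(2)[OF t(2)]
      idealD(2)[OF saturatedD(1)[OF I(1)] z(2)] by simp_all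
    have "(t \<otimes> s) \<otimes> m = t \<otimes> (z \<oplus> i)" using z(3) carr by (simp add: m_assoc)
    also have "\<dots> = (t \<otimes> z \<oplus> w) \<oplus> c \<otimes> r"
      using carr t cc by (simp add: r_distr a_assoc m_comm[of r])
    finally have eq: "(t \<otimes> s) \<otimes> m = (t \<otimes> z \<oplus> w) \<oplus> c \<otimes> r" .
    have w: "t \<otimes> z \<oplus> w \<in> Y (Suc n)"
    proof (intro idealD(4,7)[OF Yi])
      show "w \<in> Y (Suc n)" using t(2) aY(2) Yq(2) by blast
    qed (use z carr in auto)
    have "c \<otimes> r = (t \<otimes> s) \<otimes> m \<ominus> (t \<otimes> z \<oplus> w)"
      unfolding eq using carr cc t by (simp add: minus_eq a_comm[of _ "c \<otimes> r"] a_assoc r_neg)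
    also have "\<dots> \<in> Y n" 
    proof (intro idealD(5,7)[OF Yi[of n]])
      show "t \<otimes> z \<oplus> w \<in> Y n" using w Ydec by blast
    qed (use m carr in auto)
    finally have "r \<in> Y n" using saturatedD(2)[OF Yq(1), of c r n] cc cq t by simp
    then show "\<exists>s\<in>?S. \<exists>n'\<in>Y (Suc n). \<exists>m'\<in>Y n. s \<otimes> m = n' \<oplus> c \<otimes> m'"
      using eq w primeD(4)[OF p t(1) s(1)] by blast
  qed
  \<comment> \<open>Cancelling \<open>y [^] n\<close> modulo the prime \<open>q0\<close> leaves
    \<open>s \<ominus> r \<otimes> y\<close> in \<open>q0\<close>; as \<open>y\<close> is in
    \<open>q\<close>, this puts \<open>s\<close> into \<open>q\<close>.\<close>
  then have "y [^] n \<in> Y (Suc n)" using aY(3) Yq(2) by blast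
  then obtain s z r where s: "s \<in> ?U" "z \<in> q0" "r \<in> carrier R" "s \<otimes> y [^] n = z \<oplus> r \<otimes> y [^] Suc n"
    unfolding Y_def saturation_def add_mults_def by blast
  have carr: "s \<in> carrier R" "z \<in> carrier R" "y [^] n \<in> carrier R" using s iq0(2) yc by auto
  have "(s \<ominus> r \<otimes> y) \<otimes> y [^] n = s \<otimes> y [^] n \<ominus> r \<otimes> y [^] Suc n"
    using carr s(3) yc by (simp add: minus_eq l_distr l_minus m_assoc m_comm[of y])
  also have "\<dots> = z" unfolding s(4) using carr s(3) yc by (simp add: minus_eq a_assoc r_neg)
  finally have "(s \<ominus> r \<otimes> y) \<otimes> y [^] n \<in> q0" using s by simp
  moreover have "y [^] n \<notin> q0"
  proof (induction n)
    case 0 then show ?case using primeD(2)[OF q0] by simp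
  next
    case (Suc n) then show ?case using prime_mult_iff[OF q0] y yc by simp
  qed
  ultimately have "s \<ominus> r \<otimes> y \<in> q0" using primeD(3)[OF q0, of "s \<ominus> r \<otimes> y" "y [^] n"] carr s yc by simp
  then have "(s \<ominus> r \<otimes> y) \<oplus> r \<otimes> y \<in> q" using less(1) y s by (intro iq(4,7)) auto
  moreover have "(s \<ominus> r \<otimes> y) \<oplus> r \<otimes> y = s"
    using carr s(3) yc by (simp add: minus_eq a_assoc l_neg)
  ultimately show False using s by simp
qed

end

section \<open>Primes of the polynomial ring\<close>

lemma (in cring) finsum_in_ideal:
  assumes "ideal I R" "finite A" "\<And>i. i \<in> A \<Longrightarrow> f i \<in> I"
  shows "(\<Oplus>i\<in>A. f i) \<in> I"
  using assms(2,3)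
proof (induction A rule: finite_induct)
  case empty
  then show ?case using idealD(3)[OF assms(1)] by simp
next
  case (insert x F)
  have "f x \<in> carrier R" "f \<in> F \<rightarrow> carrier R" using insert.prems idealD(2)[OF assms(1)] by auto
  then show ?case using insert idealD(4)[OF assms(1)] by simp
qed

lemma ex_min_nat:
  fixes Q :: "nat \<Rightarrow> bool"
  assumes "\<exists>n. Q n"
  shows "\<exists>n. Q n \<and> (\<forall>m. Q m \<longrightarrow> n \<le> m)"
  using LeastI_ex[OF assms] Least_le[of Q] by blast

section \<open>Extension, contraction and degrees modulo a prime\<close>

context UP_cring
begin

text \<open>The ideal \<open>p[x]\<close>, that is, the extension of \<open>p\<close> to
  \<open>R[x]\<close>.\<close>

definition ext :: "'a set \<Rightarrow> (nat \<Rightarrow> 'a) set"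
  where "ext p = {f \<in> carrier P. \<forall>n. coeff P f n \<in> p}"

text \<open>The intersection of \<open>Q\<close> with \<open>R\<close>, where \<open>R\<close> is
  embedded as the constants.\<close>

definition contr :: "(nat \<Rightarrow> 'a) set \<Rightarrow> 'a set"
  where "contr Q = {a \<in> carrier R. monom P a 0 \<in> Q}"

text \<open>\<open>n\<close> is the degree of \<open>f\<close> modulo \<open>p\<close>.\<close>

definition deg_mod :: "'a set \<Rightarrow> (nat \<Rightarrow> 'a) \<Rightarrow> nat \<Rightarrow> bool"
  where "deg_mod p f n \<longleftrightarrow> f \<in> carrier P \<and> coeff P f n \<notin> p \<and> (\<forall>m>n. coeff P f m \<in> p)"

lemma ideal_ext:
  assumes "ideal p R"
  shows "ideal (ext p) P"
proof (rule P.ideal_cringI)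
  note ip = idealD[OF assms]
  show "ext p \<subseteq> carrier P" "\<zero>\<^bsub>P\<^esub> \<in> ext p" using ip(3) by (auto simp: ext_def)
  show "f \<oplus>\<^bsub>P\<^esub> g \<in> ext p" if "f \<in> ext p" "g \<in> ext p" for f g
    using that ip(4) by (auto simp: ext_def)
  show "h \<otimes>\<^bsub>P\<^esub> f \<in> ext p" if "f \<in> ext p" "h \<in> carrier P" for f h
    using that ip(7) by (auto simp: ext_def intro!: R.finsum_in_ideal[OF assms])
qed

lemma ext_mono: "p \<subseteq> q \<Longrightarrow> ext p \<subseteq> ext q"
  by (auto simp: ext_def)

lemma monom_mem_ext_iff:
  assumes "ideal p R" "a \<in> carrier R"
  shows "monom P a n \<in> ext p \<longleftrightarrow> a \<in> p"
proof
  assume "monom P a n \<in> ext p"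
  then have "coeff P (monom P a n) n \<in> p" by (simp add: ext_def del: coeff_monom)
  then show "a \<in> p" using assms by simp
next
  assume "a \<in> p"
  then show "monom P a n \<in> ext p" using assms idealD(3)[OF assms(1)] by (auto simp: ext_def)
qed

lemma contr_ext:
  assumes "ideal p R"
  shows "contr (ext p) = p"
  using assms monom_mem_ext_iff[OF assms] idealD(1)[OF assms] by (auto simp: contr_def)

lemma contr_mono: "Q \<subseteq> Q' \<Longrightarrow> contr Q \<subseteq> contr Q'"
  by (auto simp: contr_def)

lemma ext_less:
  assumes "ideal p R" "ideal q R" "p \<subset> q"
  shows "ext p \<subset> ext q"
proof -
  have "ext p \<noteq> ext q"
    by (metis contr_ext[OF assms(1)] contr_ext[OF assms(2)] assms(3) psubset_eq)
  then show ?thesis using ext_mono[OF psubset_imp_subset[OF assms(3)]] by (rule psubsetI[rotated])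
qed

lemma ideal_contr:
  assumes "ideal Q P"
  shows "ideal (contr Q) R"
proof (rule R.ideal_cringI)
  note iQ = idealD[OF assms]
  show "contr Q \<subseteq> carrier R" "\<zero> \<in> contr Q" using iQ(3) by (auto simp: contr_def)
  show "x \<oplus> y \<in> contr Q" if "x \<in> contr Q" "y \<in> contr Q" for x y
    using that iQ(4) by (auto simp: contr_def)
  show "r \<otimes> x \<in> contr Q" if "x \<in> contr Q" "r \<in> carrier R" for x r
    using that iQ(7)[of "monom P x 0" "monom P r 0"] monom_mult[of r x 0 0] by (auto simp: contr_def)
qed

lemma primeideal_contr:
  assumes "primeideal Q P"
  shows "primeideal (contr Q) R"
proof (rule R.primeideal_cringI)
  show "ideal (contr Q) R" by (rule ideal_contr[OF primeD(1)[OF assms]])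
  show "\<one> \<notin> contr Q" using primeD(2)[OF assms] by (simp add: contr_def)
  show "a \<in> contr Q \<or> b \<in> contr Q" if "a \<in> carrier R" "b \<in> carrier R" "a \<otimes> b \<in> contr Q" for a b
    using that primeD(3)[OF assms, of "monom P a 0" "monom P b 0"] monom_mult[of a b 0 0]
    by (auto simp: contr_def)
qed

text \<open>A polynomial is the sum of its monomials, and each monomial is a multiple of a constant
  in \<open>Q\<close>.\<close>

lemma ext_subset:
  assumes "ideal Q P" "p \<subseteq> contr Q"
  shows "ext p \<subseteq> Q"
proof
  fix f assume f: "f \<in> ext p"
  then have fc: "f \<in> carrier P" by (simp add: ext_def)
  have "monom P (coeff P f i) i \<in> Q" for i
  proof -
    have "coeff P f i \<in> contr Q" using f assms(2) by (auto simp: ext_def)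
    then have "monom P (coeff P f i) 0 \<otimes>\<^bsub>P\<^esub> monom P \<one> i \<in> Q"
      using idealD(8)[OF assms(1)] by (simp add: contr_def)
    then show ?thesis using monom_mult[of "coeff P f i" \<one> 0 i] fc by simp
  qed
  then have "(\<Oplus>\<^bsub>P\<^esub>i\<in>{..deg R f}. monom P (coeff P f i) i) \<in> Q"
    by (intro P.finsum_in_ideal[OF assms(1)]) simp_all
  then show "f \<in> Q" using up_repr[OF fc] by simp
qed

lemma deg_mod_exists:
  assumes "ideal p R" "f \<in> carrier P" "f \<notin> ext p"
  obtains n where "deg_mod p f n"
proof -
  let ?N = "{n. coeff P f n \<notin> p}"
  have "?N \<subseteq> {..deg R f}"
  proof
    fix n assume "n \<in> ?N"
    then show "n \<in> {..deg R f}"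
      using deg_aboveD[OF _ assms(2), of n] idealD(3)[OF assms(1)] by (cases "deg R f < n") auto
  qed
  then have fin: "finite ?N" by (rule finite_subset) simp
  have ne: "?N \<noteq> {}" using assms by (auto simp: ext_def)
  have "deg_mod p f (Max ?N)"
    unfolding deg_mod_def
  proof (intro conjI allI impI)
    show "f \<in> carrier P" by (rule assms(2))
    show "coeff P f (Max ?N) \<notin> p" using Max_in[OF fin ne] by simp
    show "coeff P f m \<in> p" if "m > Max ?N" for m
    proof (rule ccontr)
      assume "coeff P f m \<notin> p"
      then show False using Max_ge[OF fin, of m] that by simp
    qed
  qed
  then show thesis by (rule that)
qed

text \<open>Leading coefficients multiply in the polynomial ring over the domain \<open>R/p\<close>:
  in degree \<open>n + m\<close> every summand but the one at \<open>n\<close> has a factor beyond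
  the degree of \<open>f\<close> or \<open>g\<close> modulo \<open>p\<close>.\<close>

lemma deg_mod_mult:
  assumes p: "primeideal p R" and "deg_mod p f n" "deg_mod p g m"
  shows "deg_mod p (f \<otimes>\<^bsub>P\<^esub> g) (n + m)"
proof -
  note ip = idealD[OF primeD(1)[OF p]]
  have fg: "f \<in> carrier P" "g \<in> carrier P" using assms by (auto simp: deg_mod_def)
  have small: "coeff P f i \<otimes> coeff P g (k - i) \<in> p" if "k \<ge> n + m" "i \<le> k" "k = n + m \<Longrightarrow> i \<noteq> n" for i k
  proof (cases "i > n")
    case True
    then show ?thesis using assms(2) ip(8) fg by (simp add: deg_mod_def)
  next
    case False
    then have "k - i > m" using that by (cases "k = n + m") auto
    then show ?thesis using assms(3) ip(7) fg by (simp add: deg_mod_def)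
  qed
  have "coeff P (f \<otimes>\<^bsub>P\<^esub> g) k \<in> p" if "k > n + m" for k
    using fg small[of k] that by (auto intro!: R.finsum_in_ideal[OF primeD(1)[OF p]])
  moreover have "coeff P (f \<otimes>\<^bsub>P\<^esub> g) (n + m) \<notin> p"
  proof
    assume *: "coeff P (f \<otimes>\<^bsub>P\<^esub> g) (n + m) \<in> p"
    let ?t = "\<lambda>i. coeff P f i \<otimes> coeff P g (n + m - i)"
    let ?A = "{..n + m} - {n}"
    have sum: "(\<Oplus>i\<in>?A. ?t i) \<in> p"
      by (rule R.finsum_in_ideal[OF primeD(1)[OF p]]) (auto intro!: small)
    have "{..n + m} = insert n ?A" by auto
    then have "coeff P (f \<otimes>\<^bsub>P\<^esub> g) (n + m) = (\<Oplus>i\<in>insert n ?A. ?t i)" using fg by simp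
    also have "\<dots> = ?t n \<oplus> (\<Oplus>i\<in>?A. ?t i)" using fg by (subst R.finsum_insert) auto
    finally have "?t n \<oplus> (\<Oplus>i\<in>?A. ?t i) \<in> p" using * by simp
    from ip(5)[OF this sum] have "?t n \<in> p"
      using fg ip(2)[OF sum] by (simp add: R.minus_eq R.a_assoc R.r_neg)
    then show False using primeD(3)[OF p, of "coeff P f n" "coeff P g m"] fg assms
      by (auto simp: deg_mod_def)
  qed
  ultimately show ?thesis using fg by (simp add: deg_mod_def)
qed

lemma primeideal_ext:
  assumes "primeideal p R"
  shows "primeideal (ext p) P"
proof (rule P.primeideal_cringI)
  note ip = primeD(1)[OF assms]
  show "ideal (ext p) P" by (rule ideal_ext[OF ip])
  have "coeff P \<one>\<^bsub>P\<^esub> 0 \<notin> p" using primeD(2)[OF assms] by simp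
  then show "\<one>\<^bsub>P\<^esub> \<notin> ext p" unfolding ext_def by blast
  show "f \<in> ext p \<or> g \<in> ext p" if fg: "f \<in> carrier P" "g \<in> carrier P" "f \<otimes>\<^bsub>P\<^esub> g \<in> ext p" for f g
  proof (rule ccontr)
    assume "\<not> (f \<in> ext p \<or> g \<in> ext p)"
    then obtain n m where "deg_mod p f n" "deg_mod p g m" using deg_mod_exists[OF ip] fg by metis
    from deg_mod_mult[OF assms this] fg(3) show False by (auto simp: deg_mod_def ext_def)
  qed
qed

lemma smult_in_ideal:
  assumes "ideal I P" "s \<in> carrier R" "f \<in> I"
  shows "s \<odot>\<^bsub>P\<^esub> f \<in> I"
  using idealD(7)[OF assms(1,3), of "monom P s 0"] idealD(2)[OF assms(1,3)] assms(2)
  by (simp add: monom_mult_is_smult)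

lemma smult_mem_prime_iff:
  assumes Q: "primeideal Q P" and s: "s \<in> carrier R" "s \<notin> contr Q" and f: "f \<in> carrier P"
  shows "s \<odot>\<^bsub>P\<^esub> f \<in> Q \<longleftrightarrow> f \<in> Q"
proof -
  have "monom P s 0 \<notin> Q" using s by (simp add: contr_def)
  then show ?thesis
    using P.prime_mult_iff[OF Q, of "monom P s 0" f] s f by (simp add: monom_mult_is_smult)
qed

text \<open>Division with remainder modulo \<open>p[x]\<close>. The leading coefficient
  \<open>b\<close> of \<open>g\<close> is only known to be outside \<open>p\<close>, so
  \<open>f\<close> is multiplied by \<open>b\<close> before each subtraction, and \<open>s\<close>
  collects these factors. The remainder has degree less than \<open>e\<close> modulo
  \<open>p\<close>.\<close>

lemma pseudo_division:
  assumes p: "primeideal p R" and g: "deg_mod p g e" and f: "f \<in> carrier P"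
  shows "\<exists>s\<in>carrier R - p. \<exists>h\<in>carrier P. \<forall>i\<ge>e. coeff P (s \<odot>\<^bsub>P\<^esub> f \<ominus>\<^bsub>P\<^esub> h \<otimes>\<^bsub>P\<^esub> g) i \<in> p"
proof -
  note ip = idealD[OF primeD(1)[OF p]]
  have gc: "g \<in> carrier P" using g by (simp add: deg_mod_def)
  have main: "\<exists>s\<in>carrier R - p. \<exists>h\<in>carrier P. \<forall>i\<ge>e. coeff P (s \<odot>\<^bsub>P\<^esub> f \<ominus>\<^bsub>P\<^esub> h \<otimes>\<^bsub>P\<^esub> g) i \<in> p"
    if "f \<in> carrier P" "\<forall>i\<ge>e + N. coeff P f i \<in> p" for N f
    using that
  proof (induction N arbitrary: f)
    case 0
    have eq: "\<one> \<odot>\<^bsub>P\<^esub> f \<ominus>\<^bsub>P\<^esub> \<zero>\<^bsub>P\<^esub> \<otimes>\<^bsub>P\<^esub> g = f" using 0 gc by (simp add: P.minus_eq)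
    show ?case
    proof (intro bexI)
      show "\<forall>i\<ge>e. coeff P (\<one> \<odot>\<^bsub>P\<^esub> f \<ominus>\<^bsub>P\<^esub> \<zero>\<^bsub>P\<^esub> \<otimes>\<^bsub>P\<^esub> g) i \<in> p" unfolding eq using 0 by simp
    qed (use primeD(2)[OF p] in auto)
  next
    case (Suc N)
    define a b where "a = coeff P f (e + N)" and "b = coeff P g e"
    have ab: "a \<in> carrier R" "b \<in> carrier R - p" using Suc.prems g gc by (auto simp: a_def b_def deg_mod_def)
    define f' where "f' = b \<odot>\<^bsub>P\<^esub> f \<ominus>\<^bsub>P\<^esub> monom P a N \<otimes>\<^bsub>P\<^esub> g"
    have f': "f' \<in> carrier P" unfolding f'_def using ab gc Suc.prems by simp
    have "coeff P f' i \<in> p" if i: "i \<ge> e + N" for i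
    proof -
      define k where "k = i - N"
      have ik: "i = k + N" "k \<ge> e" using i by (auto simp: k_def)
      have co: "coeff P f' i = b \<otimes> coeff P f i \<ominus> a \<otimes> coeff P g k"
        unfolding f'_def ik(1) using coeff_monom_mult[OF ab(1) gc, of N k] ab gc Suc.prems(1)
        by (simp del: coeff_mult add: add.commute)
      show ?thesis
      proof (cases "k = e")
        case True
        then have "coeff P f' i = b \<otimes> a \<ominus> a \<otimes> b" using co ik by (simp add: a_def b_def)
        then show ?thesis using ab ip(3) by (simp add: R.m_comm R.minus_eq R.r_neg)
      next
        case False
        then have "coeff P f i \<in> p" "coeff P g k \<in> p" using Suc.prems(2) g ik by (auto simp: deg_mod_def)
        then show ?thesis unfolding co using ab by (intro ip(5,7)) auto
      qed
    qed
    with Suc.IH[OF f'] obtain s h where s: "s \<in> carrier R - p" "h \<in> carrier P"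
      "\<And>i. i \<ge> e \<Longrightarrow> coeff P (s \<odot>\<^bsub>P\<^esub> f' \<ominus>\<^bsub>P\<^esub> h \<otimes>\<^bsub>P\<^esub> g) i \<in> p" by blast
    have sb: "s \<otimes> b \<in> carrier R - p" by (rule primeD(4)[OF p s(1) ab(2)])
    have m: "monom P a N \<in> carrier P" "s \<odot>\<^bsub>P\<^esub> monom P a N \<in> carrier P" using ab s by auto
    have "s \<odot>\<^bsub>P\<^esub> f' = s \<odot>\<^bsub>P\<^esub> (b \<odot>\<^bsub>P\<^esub> f) \<ominus>\<^bsub>P\<^esub> s \<odot>\<^bsub>P\<^esub> (monom P a N \<otimes>\<^bsub>P\<^esub> g)"
      unfolding f'_def using s ab gc Suc.prems(1)
      by (simp add: monom_mult_is_smult[symmetric] P.minus_eq P.r_distr P.r_minus)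
    also have "\<dots> = (s \<otimes> b) \<odot>\<^bsub>P\<^esub> f \<ominus>\<^bsub>P\<^esub> (s \<odot>\<^bsub>P\<^esub> monom P a N) \<otimes>\<^bsub>P\<^esub> g"
      using s ab gc Suc.prems(1) by (simp add: UP_smult_assoc1 UP_smult_assoc2)
    finally have "s \<odot>\<^bsub>P\<^esub> f' \<ominus>\<^bsub>P\<^esub> h \<otimes>\<^bsub>P\<^esub> g
        = (s \<otimes> b) \<odot>\<^bsub>P\<^esub> f \<ominus>\<^bsub>P\<^esub> (s \<odot>\<^bsub>P\<^esub> monom P a N \<oplus>\<^bsub>P\<^esub> h) \<otimes>\<^bsub>P\<^esub> g"
      using sb s(2) gc Suc.prems(1) m(2)
      by (simp add: P.minus_eq P.l_distr P.minus_add P.a_assoc)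
    with s(3) have "\<forall>i\<ge>e. coeff P ((s \<otimes> b) \<odot>\<^bsub>P\<^esub> f
        \<ominus>\<^bsub>P\<^esub> (s \<odot>\<^bsub>P\<^esub> monom P a N \<oplus>\<^bsub>P\<^esub> h) \<otimes>\<^bsub>P\<^esub> g) i \<in> p" by simp
    moreover have "s \<odot>\<^bsub>P\<^esub> monom P a N \<oplus>\<^bsub>P\<^esub> h \<in> carrier P" using m(2) s(2) by simp
    ultimately show ?case using sb by blast
  qed
  have "\<forall>i\<ge>e + Suc (deg R f). coeff P f i \<in> p" using deg_aboveD[OF _ f] ip(3) by auto
  from main[OF f this] show ?thesis .
qed

text \<open>Elements of least degree modulo \<open>p\<close> in \<open>Q1\<close> and in \<open>Q2 - Q1\<close> are compared by pseudo-division;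
  this replaces the passage to the principal ideal domain \<open>K[x]\<close>, \<open>K\<close> the residue field at \<open>p\<close>.\<close>

lemma fibre_chain:
  assumes Q1: "primeideal Q1 P" and Q2: "primeideal Q2 P" and less: "Q1 \<subset> Q2"
    and contr: "contr Q2 = contr Q1"
  shows "Q1 = ext (contr Q1)"
proof (rule ccontr)
  assume ne: "Q1 \<noteq> ext (contr Q1)"
  define p where "p = contr Q1"
  have p: "primeideal p R" unfolding p_def by (rule primeideal_contr[OF Q1])
  note ip = idealD[OF primeD(1)[OF p]]
  note i1 = idealD[OF primeD(1)[OF Q1]] and i2 = idealD[OF primeD(1)[OF Q2]]
  have pe: "primeideal (ext p) P" by (rule primeideal_ext[OF p])
  note ie = idealD[OF primeD(1)[OF pe]]
  have ext1: "ext p \<subseteq> Q1" using ext_subset[OF primeD(1)[OF Q1]] by (simp add: p_def)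
  have "\<exists>n. \<exists>f\<in>Q1. deg_mod p f n"
    using ne ext1 deg_mod_exists[OF primeD(1)[OF p]] i1(2) unfolding p_def by blast
  from ex_min_nat[OF this] obtain d where "\<exists>f\<in>Q1. deg_mod p f d"
    and dleast: "\<forall>n. (\<exists>f\<in>Q1. deg_mod p f n) \<longrightarrow> d \<le> n"
    by (elim exE conjE)
  then obtain f where f: "f \<in> Q1" "deg_mod p f d" by blast
  have dmin: "d \<le> n" if "h \<in> Q1" "deg_mod p h n" for h n
    using dleast that by blast
  obtain g' where g': "g' \<in> Q2" "g' \<notin> Q1" using less by blast
  then have "g' \<notin> ext p" using ext1 by blast
  then obtain n' where "deg_mod p g' n'" by (rule deg_mod_exists[OF primeD(1)[OF p] i2(2)[OF g'(1)]])
  then have "\<exists>n. \<exists>f\<in>Q2 - Q1. deg_mod p f n" using g' by blast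
  from ex_min_nat[OF this] obtain e where "\<exists>f\<in>Q2 - Q1. deg_mod p f e"
    and eleast: "\<forall>n. (\<exists>f\<in>Q2 - Q1. deg_mod p f n) \<longrightarrow> e \<le> n"
    by (elim exE conjE)
  then obtain g where g: "g \<in> Q2 - Q1" "deg_mod p g e" by blast
  have emin: "e \<le> n" if "h \<in> Q2 - Q1" "deg_mod p h n" for h n
    using eleast that by blast
  have fc: "f \<in> carrier P" "g \<in> carrier P" using f g by (auto simp: deg_mod_def)
  \<comment> \<open>By minimality of \<open>e\<close>, anything in \<open>Q2\<close> of smaller
    degree modulo \<open>p\<close> is already in \<open>Q1\<close>; this is how remainders are
    handled.\<close>
  have below: "h \<in> Q1" if h: "h \<in> Q2" "\<And>i. i \<ge> e \<Longrightarrow> coeff P h i \<in> p" for h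
  proof (rule ccontr)
    assume n: "h \<notin> Q1"
    then have "h \<notin> ext p" using ext1 by blast
    then obtain k where k: "deg_mod p h k" by (rule deg_mod_exists[OF primeD(1)[OF p] i2(2)[OF h(1)]])
    then have "e \<le> k" using emin h n by blast
    then show False using h(2) k by (auto simp: deg_mod_def)
  qed
  \<comment> \<open>If \<open>d\<close> were at most \<open>e\<close>, dividing \<open>g\<close> by
    \<open>f\<close> would leave a remainder in \<open>Q1\<close>, and \<open>g\<close> would follow
    it into \<open>Q1\<close>.\<close>
  have ed: "e < d"
  proof (rule ccontr)
    assume "\<not> e < d"
    obtain s h where s: "s \<in> carrier R - p" "h \<in> carrier P"
      "\<And>i. i \<ge> d \<Longrightarrow> coeff P (s \<odot>\<^bsub>P\<^esub> g \<ominus>\<^bsub>P\<^esub> h \<otimes>\<^bsub>P\<^esub> f) i \<in> p"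
      using pseudo_division[OF p f(2) fc(2)] by blast
    have hf: "h \<otimes>\<^bsub>P\<^esub> f \<in> Q1" using f(1) s(2) by (rule i1(7))
    have "s \<odot>\<^bsub>P\<^esub> g \<in> Q2" using smult_in_ideal[OF primeD(1)[OF Q2]] s(1) g(1) by blast
    then have "s \<odot>\<^bsub>P\<^esub> g \<ominus>\<^bsub>P\<^esub> h \<otimes>\<^bsub>P\<^esub> f \<in> Q2" using hf less by (intro i2(5)) auto
    then have "s \<odot>\<^bsub>P\<^esub> g \<ominus>\<^bsub>P\<^esub> h \<otimes>\<^bsub>P\<^esub> f \<in> Q1" using below s(3) \<open>\<not> e < d\<close> by simp
    from i1(4)[OF this hf] have "s \<odot>\<^bsub>P\<^esub> g \<in> Q1"
      using s fc by (simp add: P.minus_eq P.a_assoc P.l_neg)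
    then show False using smult_mem_prime_iff[OF Q1, of s g] s(1) fc g(1) unfolding p_def by blast
  qed
  \<comment> \<open>For \<open>e = 0\<close>, \<open>g\<close> is a constant modulo
    \<open>p[x]\<close>, and the constant lies in \<open>contr Q2 = p\<close>. This is where
    equality of the contractions enters.\<close>
  have e0: "e > 0"
  proof (rule ccontr)
    assume "\<not> e > 0"
    then have t0: "deg_mod p g 0" using g(2) by simp
    have "g \<ominus>\<^bsub>P\<^esub> monom P (coeff P g 0) 0 \<in> ext p"
      using t0 fc ip(3) by (auto simp: ext_def deg_mod_def R.minus_eq R.r_neg)
    then have "g \<ominus>\<^bsub>P\<^esub> monom P (coeff P g 0) 0 \<in> Q2" using ext1 less by blast
    from i2(5)[OF _ this, of g] g(1)
    have "g \<ominus>\<^bsub>P\<^esub> (g \<ominus>\<^bsub>P\<^esub> monom P (coeff P g 0) 0) \<in> Q2" by simp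
    also have "g \<ominus>\<^bsub>P\<^esub> (g \<ominus>\<^bsub>P\<^esub> monom P (coeff P g 0) 0) = monom P (coeff P g 0) 0"
      using fc by (simp add: P.minus_eq P.minus_add P.a_assoc[symmetric] P.r_neg)
    finally have "coeff P g 0 \<in> contr Q2" using fc by (simp add: contr_def)
    then show False using t0 contr by (simp add: deg_mod_def p_def)
  qed
  obtain s h where s: "s \<in> carrier R - p" "h \<in> carrier P"
    and rest: "\<And>i. i \<ge> e \<Longrightarrow> coeff P (s \<odot>\<^bsub>P\<^esub> f \<ominus>\<^bsub>P\<^esub> h \<otimes>\<^bsub>P\<^esub> g) i \<in> p"
    using pseudo_division[OF p g(2) fc(1)] by blast
  define r where "r = s \<odot>\<^bsub>P\<^esub> f \<ominus>\<^bsub>P\<^esub> h \<otimes>\<^bsub>P\<^esub> g"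
  have sf1: "s \<odot>\<^bsub>P\<^esub> f \<in> Q1" using smult_in_ideal[OF primeD(1)[OF Q1]] s(1) f(1) by blast
  have "h \<otimes>\<^bsub>P\<^esub> g \<in> Q2" using g(1) s(2) by (intro i2(7)) auto
  then have "r \<in> Q2" unfolding r_def using sf1 less by (intro i2(5)) auto
  then have r1: "r \<in> Q1" using below rest unfolding r_def by blast
  \<comment> \<open>The remainder lies in \<open>Q1\<close> and has degree below
    \<open>e < d\<close> modulo \<open>p\<close>, which the minimality of \<open>d\<close> permits
    only for elements of \<open>p[x]\<close>.\<close>
  have "r \<in> ext p"
  proof (rule ccontr)
    assume "r \<notin> ext p"
    then obtain k where k: "deg_mod p r k" by (rule deg_mod_exists[OF primeD(1)[OF p] i1(2)[OF r1]])
    then have "d \<le> k" using dmin r1 by blast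
    then show False using rest[of k] ed k by (auto simp: deg_mod_def r_def)
  qed
  have rc: "r \<in> carrier P" by (rule i1(2)[OF r1])
  have hg: "h \<otimes>\<^bsub>P\<^esub> g = s \<odot>\<^bsub>P\<^esub> f \<ominus>\<^bsub>P\<^esub> r"
    unfolding r_def using s fc by (simp add: P.minus_eq P.minus_add P.a_assoc[symmetric] P.r_neg)
  also have "\<dots> \<in> Q1" using sf1 r1 by (rule i1(5))
  finally have "h \<in> Q1" using primeD(3)[OF Q1 s(2) fc(2)] g(1) by blast
  \<comment> \<open>Otherwise \<open>h\<close>, being in \<open>Q1\<close>, has degree at least
    \<open>d\<close> modulo \<open>p\<close>, and \<open>h\<close> times \<open>g\<close> has degree
    at least \<open>d + e > d\<close>. But modulo \<open>p[x]\<close> this product is a multiple of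
    \<open>f\<close> by a constant.\<close>
  have "h \<in> ext p"
  proof (rule ccontr)
    assume "h \<notin> ext p"
    then obtain k where k: "deg_mod p h k" by (rule deg_mod_exists[OF primeD(1)[OF p] s(2)])
    then have dk: "d \<le> k" using dmin \<open>h \<in> Q1\<close> by blast
    have "coeff P (s \<odot>\<^bsub>P\<^esub> f \<ominus>\<^bsub>P\<^esub> r) (k + e) \<in> p"
    proof -
      have "coeff P f (k + e) \<in> p" using f(2) dk e0 by (simp add: deg_mod_def)
      then have "s \<otimes> coeff P f (k + e) \<ominus> coeff P r (k + e) \<in> p"
        using s(1) \<open>r \<in> ext p\<close> by (intro ip(5,7)) (auto simp: ext_def)
      then show ?thesis using s fc rc by simp
    qed
    then show False using deg_mod_mult[OF p k g(2)] unfolding hg deg_mod_def by blast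
  qed
  then have "h \<otimes>\<^bsub>P\<^esub> g \<in> ext p" using ie(8) fc by blast
  then have "h \<otimes>\<^bsub>P\<^esub> g \<oplus>\<^bsub>P\<^esub> r \<in> ext p" using \<open>r \<in> ext p\<close> by (rule ie(4))
  then have "s \<odot>\<^bsub>P\<^esub> f \<in> ext p" unfolding hg using s fc rc
    by (simp add: P.minus_eq P.a_assoc P.l_neg)
  then have "f \<in> ext p" using smult_mem_prime_iff[OF pe, of s f] s(1) fc contr_ext[OF primeD(1)[OF p]] by simp
  then show False using f(2) by (simp add: ext_def deg_mod_def)
qed

end

section \<open>A saturated Hilbert basis theorem\<close>

context UP_cring
begin

text \<open>The \<open>p\<close>-saturation of the ideal of coefficients at \<open>n\<close> of the
  elements of \<open>I\<close> of degree at most \<open>n\<close>; the factor \<open>s\<close>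
  builds the saturation in.\<close>

definition lead :: "'a set \<Rightarrow> (nat \<Rightarrow> 'a) set \<Rightarrow> nat \<Rightarrow> 'a set"
  where "lead p I n = {a \<in> carrier R. \<exists>s\<in>carrier R - p. \<exists>f\<in>I.
    (\<forall>m>n. coeff P f m = \<zero>) \<and> coeff P f n = s \<otimes> a}"

lemma leadI:
  assumes "a \<in> carrier R" "s \<in> carrier R - p" "f \<in> I" "\<forall>m>n. coeff P f m = \<zero>"
    "coeff P f n = s \<otimes> a"
  shows "a \<in> lead p I n"
  using assms unfolding lead_def by blast

lemma leadE:
  assumes "a \<in> lead p I n"
  obtains s f where "a \<in> carrier R" "s \<in> carrier R - p" "f \<in> I" "\<forall>m>n. coeff P f m = \<zero>"
    "coeff P f n = s \<otimes> a"
  using assms unfolding lead_def by blast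

lemma saturated_lead:
  assumes p: "primeideal p R" and I: "ideal I P"
  shows "saturated R (carrier R - p) (lead p I n)"
proof -
  note iI = idealD[OF I]
  have "ideal (lead p I n) R"
  proof (rule R.ideal_cringI)
    show "lead p I n \<subseteq> carrier R" by (auto simp: lead_def)
    show "\<zero> \<in> lead p I n" by (rule leadI[OF _ primeD(2)[OF p] iI(3)]) simp_all
  next
    fix a b assume "a \<in> lead p I n" "b \<in> lead p I n"
    from this(1) obtain s f where a: "a \<in> carrier R" "s \<in> carrier R - p" "f \<in> I"
      "\<forall>m>n. coeff P f m = \<zero>" "coeff P f n = s \<otimes> a" by (rule leadE)
    from \<open>b \<in> lead p I n\<close> obtain t g where b: "b \<in> carrier R" "t \<in> carrier R - p" "g \<in> I"
      "\<forall>m>n. coeff P g m = \<zero>" "coeff P g n = t \<otimes> b" by (rule leadE)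
    have fg: "f \<in> carrier P" "g \<in> carrier P" "s \<in> carrier R" "t \<in> carrier R"
      using iI(2)[OF a(3)] iI(2)[OF b(3)] a(2) b(2) by simp_all
    show "a \<oplus> b \<in> lead p I n"
    proof (rule leadI[OF _ primeD(4)[OF p a(2) b(2)], where f = "t \<odot>\<^bsub>P\<^esub> f \<oplus>\<^bsub>P\<^esub> s \<odot>\<^bsub>P\<^esub> g"])
      show "t \<odot>\<^bsub>P\<^esub> f \<oplus>\<^bsub>P\<^esub> s \<odot>\<^bsub>P\<^esub> g \<in> I"
        using smult_in_ideal[OF I] a b fg by (intro iI(4)) auto
    qed (use a b fg in \<open>simp_all add: R.r_distr R.m_ac\<close>)
  next
    fix r a assume r: "r \<in> carrier R" and "a \<in> lead p I n"
    from this(2) obtain s f where a: "a \<in> carrier R" "s \<in> carrier R - p" "f \<in> I"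
      "\<forall>m>n. coeff P f m = \<zero>" "coeff P f n = s \<otimes> a" by (rule leadE)
    have fs: "f \<in> carrier P" "s \<in> carrier R" using iI(2)[OF a(3)] a(2) by simp_all
    show "r \<otimes> a \<in> lead p I n"
      by (rule leadI[OF _ a(2) smult_in_ideal[OF I r a(3)]]) (use a r fs in \<open>simp_all add: R.m_ac\<close>)
  qed
  moreover have "a \<in> lead p I n"
    if ta: "t \<in> carrier R - p" "a \<in> carrier R" "t \<otimes> a \<in> lead p I n" for t a
  proof -
    from ta(3) obtain s f where a: "s \<in> carrier R - p" "f \<in> I"
      "\<forall>m>n. coeff P f m = \<zero>" "coeff P f n = s \<otimes> (t \<otimes> a)" by (rule leadE)
    show ?thesis
      by (rule leadI[OF ta(2) primeD(4)[OF p a(1) ta(1)] a(2,3)]) (use a ta in \<open>simp_all add: R.m_assoc\<close>)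
  qed
  ultimately show ?thesis unfolding saturated_def by blast
qed

lemma lead_mono: "I \<subseteq> J \<Longrightarrow> lead p I n \<subseteq> lead p J n"
  unfolding lead_def by blast

text \<open>Multiplication by \<open>x\<close> moves the leading coefficient up by one
  place.\<close>

lemma lead_Suc:
  assumes I: "ideal I P"
  shows "lead p I n \<subseteq> lead p I (Suc n)"
proof
  fix a assume "a \<in> lead p I n"
  then obtain s f where a: "a \<in> carrier R" "s \<in> carrier R - p" "f \<in> I"
    "\<forall>m>n. coeff P f m = \<zero>" "coeff P f n = s \<otimes> a" by (rule leadE)
  have f: "f \<in> carrier P" using idealD(2)[OF I a(3)] .
  have co: "coeff P (monom P \<one> 1 \<otimes>\<^bsub>P\<^esub> f) (Suc m) = coeff P f m" for m
    using coeff_monom_mult[OF R.one_closed f, of 1 m] f by (simp del: coeff_mult)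
  show "a \<in> lead p I (Suc n)"
  proof (rule leadI[OF a(1,2)])
    show "monom P \<one> 1 \<otimes>\<^bsub>P\<^esub> f \<in> I" using idealD(7)[OF I a(3)] by simp
    show "\<forall>m>Suc n. coeff P (monom P \<one> 1 \<otimes>\<^bsub>P\<^esub> f) m = \<zero>"
    proof (intro allI impI)
      fix m assume "m > Suc n"
      then show "coeff P (monom P \<one> 1 \<otimes>\<^bsub>P\<^esub> f) m = \<zero>" using co[of "m - 1"] a(4) by simp
    qed
    show "coeff P (monom P \<one> 1 \<otimes>\<^bsub>P\<^esub> f) (Suc n) = s \<otimes> a" unfolding co by (rule a(5))
  qed
qed

lemma subset_of_lead:
  assumes p: "primeideal p R" and I: "ideal I P" and J: "ideal J P" and IJ: "I \<subseteq> J"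
    and sat: "\<And>s f. s \<in> carrier R - p \<Longrightarrow> f \<in> carrier P \<Longrightarrow> s \<odot>\<^bsub>P\<^esub> f \<in> I \<Longrightarrow> f \<in> I"
    and lead: "\<And>n. lead p J n \<subseteq> lead p I n"
  shows "J \<subseteq> I"
proof
  note iI = idealD[OF I] and iJ = idealD[OF J]
  have main: "f \<in> I" if "f \<in> J" "\<And>m. m \<ge> N \<Longrightarrow> coeff P f m = \<zero>" for N f
    using that
  proof (induction N arbitrary: f)
    case 0
    then have "f = \<zero>\<^bsub>P\<^esub>" using iJ(2) by (intro up_eqI) auto
    then show ?case using iI(3) by simp
  next
    case (Suc N)
    have f: "f \<in> carrier P" by (rule iJ(2)[OF Suc.prems(1)])
    have "coeff P f N \<in> lead p J N"
      by (rule leadI[OF _ primeD(2)[OF p] Suc.prems(1)]) (use Suc.prems(2) f in auto)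
    with lead have "coeff P f N \<in> lead p I N" by blast
    then obtain s g where g: "s \<in> carrier R - p" "g \<in> I"
      "\<forall>m>N. coeff P g m = \<zero>" "coeff P g N = s \<otimes> coeff P f N" by (rule leadE)
    have gc: "g \<in> carrier P" "s \<in> carrier R" using iI(2)[OF g(2)] g(1) by auto
    let ?h = "s \<odot>\<^bsub>P\<^esub> f \<ominus>\<^bsub>P\<^esub> g"
    have "?h \<in> I"
    proof (rule Suc.IH)
      show "?h \<in> J" using smult_in_ideal[OF J gc(2) Suc.prems(1)] g(2) IJ by (intro iJ(5)) auto
      show "coeff P ?h m = \<zero>" if "m \<ge> N" for m
        using that g(3) g(4) Suc.prems(2)[of m] f gc
        by (cases "m = N") (auto simp: R.minus_eq R.r_neg)
    qed
    from iI(4)[OF this g(2)] have "s \<odot>\<^bsub>P\<^esub> f \<in> I"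
      using f gc by (simp add: P.minus_eq P.a_assoc P.l_neg)
    then show ?case by (rule sat[OF g(1) f])
  qed
  fix f assume f: "f \<in> J"
  show "f \<in> I"
    by (rule main[OF f, of "Suc (deg R f)"]) (use deg_aboveD[OF _ iJ(2)[OF f]] in auto)
qed

text \<open>The array \<open>L k n\<close> of saturated leading ideals increases in both indices.
  Its diagonal is stationary from \<open>k0\<close> on, and only the finitely many sequences with
  \<open>n < k0\<close> remain, each of them stationary from \<open>K n\<close> on.\<close>

theorem acc_saturated_UP:
  assumes p: "primeideal p R" and acc: "acc_on {I. saturated R (carrier R - p) I}"
  shows "acc_on {I. saturated P (carrier P - ext p) I}"
  unfolding acc_on_def
proof (intro allI impI, elim conjE)
  fix I :: "nat \<Rightarrow> (nat \<Rightarrow> 'a) set"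
  assume "\<forall>n. I n \<in> {I. saturated P (carrier P - ext p) I}" and incr: "\<forall>n. I n \<subseteq> I (Suc n)"
  then have sat: "saturated P (carrier P - ext p) (I n)" for n by blast
  have iI: "ideal (I n) P" for n using saturatedD(1)[OF sat] .
  have mono: "I n \<subseteq> I m" if "n \<le> m" for n m
    by (rule lift_Suc_mono_le[of I, OF _ that]) (rule incr[rule_format])
  have csat: "f \<in> I n" if "s \<in> carrier R - p" "f \<in> carrier P" "s \<odot>\<^bsub>P\<^esub> f \<in> I n" for s f n
  proof (rule saturatedD(2)[OF sat _ that(2)])
    show "monom P s 0 \<in> carrier P - ext p"
      using that(1) monom_mem_ext_iff[OF primeD(1)[OF p]] by simp
    show "monom P s 0 \<otimes>\<^bsub>P\<^esub> f \<in> I n" using that by (simp add: monom_mult_is_smult)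
  qed
  define L where "L k n = lead p (I k) n" for k n
  have Lsat: "L k n \<in> {I. saturated R (carrier R - p) I}" for k n
    using saturated_lead[OF p iI] unfolding L_def by simp
  have Lmono1: "L k n \<subseteq> L k' n" if "k \<le> k'" for k k' n
    unfolding L_def by (rule lead_mono[OF mono[OF that]])
  have Lmono: "L k n \<subseteq> L k' n'" if "k \<le> k'" "n \<le> n'" for k k' n n'
  proof -
    have "L k' n \<subseteq> L k' n'"
      unfolding L_def by (rule lift_Suc_mono_le[of "lead p (I k')", OF _ that(2)]) (rule lead_Suc[OF iI])
    then show ?thesis using Lmono1[OF that(1)] by blast
  qed
  have "\<exists>k. \<forall>n\<ge>k. L n n = L k k"
    by (rule acc_onD[where I = "\<lambda>n. L n n", OF acc]) (intro Lsat Lmono le_SucI order_refl)+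
  then obtain k0 where k0: "\<And>n. n \<ge> k0 \<Longrightarrow> L n n = L k0 k0" by blast
  have "\<exists>K. \<forall>k\<ge>K. L k n = L K n" for n
    by (rule acc_onD[where I = "\<lambda>k. L k n", OF acc]) (intro Lsat Lmono le_SucI order_refl)+
  then obtain K where K: "\<And>n k. k \<ge> K n \<Longrightarrow> L k n = L (K n) n" by metis
  \<comment> \<open>The sum is merely a common upper bound of \<open>k0\<close> and of all
    \<open>K n\<close> with \<open>n < k0\<close>.\<close>
  define k1 where "k1 = k0 + (\<Sum>n<k0. K n)"
  have "I k = I k1" if k: "k \<ge> k1" for k
  proof
    show "I k1 \<subseteq> I k" by (rule mono[OF k])
    have "L k n \<subseteq> L k1 n" for n
    proof (cases "n < k0")
      case True
      then have "K n \<le> k1" unfolding k1_def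
        using member_le_sum[of n "{..<k0}" K] by simp
      then show ?thesis using K[of n k] K[of n k1] k by simp
    next
      case False
      have "L k n \<subseteq> L (max k n) (max k n)" by (rule Lmono) auto
      also have "\<dots> = L k0 k0" using False by (intro k0) auto
      also have "\<dots> \<subseteq> L k1 n" using False by (intro Lmono) (auto simp: k1_def)
      finally show ?thesis .
    qed
    then show "I k \<subseteq> I k1"
      by (intro subset_of_lead[OF p iI iI mono[OF k] csat]) (auto simp: L_def)
  qed
  then show "\<exists>k. \<forall>n\<ge>k. I n = I k" by blast
qed

end

section \<open>Heights of extended primes\<close>

definition chain_to :: "('a, 'r) ring_scheme \<Rightarrow> 'a set \<Rightarrow> nat \<Rightarrow> bool"
  where "chain_to A p n \<longleftrightarrow> (\<exists>C. prime_chain A C n \<and> C n = p)"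

lemma height_alt: "height A p = Sup {enat n | n. chain_to A p n}"
  unfolding height_def chain_to_def by simp

lemma chain_to_prime: "chain_to A p n \<Longrightarrow> primeideal p A"
  unfolding chain_to_def prime_chain_def by blast

lemma chain_to_0: "primeideal p A \<Longrightarrow> chain_to A p 0"
  unfolding chain_to_def prime_chain_def by (intro exI[of _ "\<lambda>_. p"]) auto

lemma chain_to_Suc:
  assumes "chain_to A q n" "primeideal p A" "q \<subset> p"
  shows "chain_to A p (Suc n)"
proof -
  obtain C where C: "prime_chain A C n" "C n = q" using assms(1) unfolding chain_to_def by blast
  have "prime_chain A (C(Suc n := p)) (Suc n)"
    using C assms(2,3) unfolding prime_chain_def by (auto simp: less_Suc_eq le_Suc_eq)
  then show ?thesis unfolding chain_to_def by (intro exI[of _ "C(Suc n := p)"]) simp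
qed

lemma chain_to_SucE:
  assumes "chain_to A p (Suc n)"
  obtains q where "chain_to A q n" "q \<subset> p"
proof -
  obtain C where C: "prime_chain A C (Suc n)" "C (Suc n) = p"
    using assms unfolding chain_to_def by blast
  show thesis
  proof (rule that)
    have "prime_chain A C n" using C(1) by (auto simp: prime_chain_def)
    then show "chain_to A (C n) n" unfolding chain_to_def by blast
    show "C n \<subset> p" using C by (auto simp: prime_chain_def)
  qed
qed

text \<open>The smallest prime of the chain is discarded.\<close>

lemma chain_to_less: "chain_to A p (Suc n) \<Longrightarrow> chain_to A p n"
proof (induction n arbitrary: p)
  case 0
  then show ?case using chain_to_0 chain_to_prime by blast
next
  case (Suc n)
  from Suc.prems obtain q where q: "chain_to A q (Suc n)" "q \<subset> p" by (rule chain_to_SucE)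
  show ?case by (rule chain_to_Suc[OF Suc.IH[OF q(1)] chain_to_prime[OF Suc.prems] q(2)])
qed

lemma chain_to_enlarge:
  assumes "chain_to A q n" "primeideal p A" "q \<subseteq> p"
  shows "chain_to A p n"
proof (cases "q = p")
  case False
  then show ?thesis using chain_to_less[OF chain_to_Suc[OF assms(1,2)]] assms(3) by blast
qed (use assms in simp)

context UP_cring
begin

text \<open>Take \<open>c\<close> in \<open>p\<close> outside \<open>p'\<close>. Because of
  \<open>Q\<close>, the principal ideal theorem in \<open>R[x]\<close> supplies a prime
  \<open>q'\<close> properly inside \<open>p[x]\<close> containing \<open>p'[x]\<close> and the
  constant \<open>c\<close>. Its contraction is larger than \<open>p'\<close> because of
  \<open>c\<close>, and it is not \<open>p\<close>, since otherwise \<open>q'\<close> would contain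
  \<open>p[x]\<close>.\<close>

lemma prime_between:
  assumes p: "primeideal p R" and acc: "acc_on {I. saturated R (carrier R - p) I}"
    and p': "primeideal p' R" and Q: "primeideal Q P" and less: "ext p' \<subset> Q" "Q \<subset> ext p"
  obtains p'' where "primeideal p'' R" "p' \<subset> p''" "p'' \<subset> p"
proof -
  have "\<not> p \<subseteq> p'" using less ext_mono[of p p'] by blast
  then obtain c where c: "c \<in> p" "c \<notin> p'" by blast
  have cc: "c \<in> carrier R" by (rule idealD(2)[OF primeD(1)[OF p] c(1)])
  have "monom P c 0 \<in> ext p" using monom_mem_ext_iff[OF primeD(1)[OF p] cc] c by blast
  then obtain q' where q': "primeideal q' P" "ext p' \<subseteq> q'" "monom P c 0 \<in> q'" "q' \<subset> ext p"
    by (rule P.principal_ideal_theorem[OF primeideal_ext[OF p] acc_saturated_UP[OF p acc]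
        primeideal_ext[OF p'] Q less])
  show thesis
  proof (rule that)
    show "primeideal (contr q') R" by (rule primeideal_contr[OF q'(1)])
    have "contr (ext p') \<subseteq> contr q'" by (rule contr_mono[OF q'(2)])
    moreover have "c \<in> contr q'" using q'(3) cc by (simp add: contr_def)
    ultimately show "p' \<subset> contr q'" using c(2) contr_ext[OF primeD(1)[OF p']] by blast
    have "contr q' \<subseteq> contr (ext p)" by (rule contr_mono[OF psubset_imp_subset[OF q'(4)]])
    moreover have "contr q' \<noteq> p" using ext_subset[OF primeD(1)[OF q'(1)], of p] q'(4) by blast
    ultimately show "contr q' \<subset> p" using contr_ext[OF primeD(1)[OF p]] by blast
  qed
qed

text \<open>Contraction costs at most one step in total, and none if the top prime is extended. If
  the last step \<open>Q' \<subset> Q\<close> contracts to an equality, then \<open>Q'\<close> is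
  extended by \<open>fibre_chain\<close>, so nothing was lost before. If \<open>Q\<close> is
  extended and \<open>Q'\<close> is not, then \<open>Q'\<close> lies strictly between two extended
  primes, and \<open>prime_between\<close> supplies the missing prime.\<close>

lemma chain_to_contr:
  assumes p: "primeideal p R" and acc: "acc_on {I. saturated R (carrier R - p) I}"
    and "chain_to P Q m" "Q \<subseteq> ext p"
  shows "chain_to R (contr Q) (m - 1) \<and> (Q = ext (contr Q) \<longrightarrow> chain_to R (contr Q) m)"
  using assms(3,4)
proof (induction m arbitrary: Q)
  case 0
  then show ?case using chain_to_0[OF primeideal_contr[OF chain_to_prime]] by auto
next
  case (Suc m)
  have Q: "primeideal Q P" by (rule chain_to_prime[OF Suc.prems(1)])
  have pQ: "primeideal (contr Q) R" by (rule primeideal_contr[OF Q])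
  from Suc.prems(1) obtain Q' where Q': "chain_to P Q' m" "Q' \<subset> Q" by (rule chain_to_SucE)
  have pQ': "primeideal Q' P" by (rule chain_to_prime[OF Q'(1)])
  have pc': "primeideal (contr Q') R" by (rule primeideal_contr[OF pQ'])
  have IH: "chain_to R (contr Q') (m - 1)" "Q' = ext (contr Q') \<Longrightarrow> chain_to R (contr Q') m"
    using Suc.IH[OF Q'(1)] Q'(2) Suc.prems(2) by blast+
  have le: "contr Q' \<subseteq> contr Q" by (rule contr_mono[OF psubset_imp_subset[OF Q'(2)]])
  have main: "chain_to R (contr Q) m"
  proof (cases "contr Q' = contr Q")
    case True
    then have "Q' = ext (contr Q')" using fibre_chain[OF pQ' Q Q'(2)] by simp
    then show ?thesis using IH(2) True by simp
  next
    case False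
    then have "contr Q' \<subset> contr Q" using le by blast
    then have "chain_to R (contr Q) (Suc (m - 1))" by (rule chain_to_Suc[OF IH(1) pQ])
    \<comment> \<open>\<open>Suc (m - 1)\<close> is \<open>m\<close> except for
      \<open>m = 0\<close>, where the chain consisting of \<open>contr Q\<close> alone is
      enough.\<close>
    then show ?thesis by (cases m) (auto intro: chain_to_0[OF pQ])
  qed
  moreover have "chain_to R (contr Q) (Suc m)" if ext: "Q = ext (contr Q)"
  proof -
    have "contr Q' \<noteq> contr Q"
    proof
      assume "contr Q' = contr Q"
      then have "Q \<subseteq> Q'" using ext_subset[OF primeD(1)[OF pQ'], of "contr Q"] ext by simp
      then show False using Q'(2) by blast
    qed
    then have less: "contr Q' \<subset> contr Q" using le by blast
    show ?thesis
    proof (cases "Q' = ext (contr Q')")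
      case True
      show ?thesis by (rule chain_to_Suc[OF IH(2)[OF True] pQ less])
    next
      case False
      have "ext (contr Q') \<subset> Q'"
        using ext_subset[OF primeD(1)[OF pQ'] order_refl] False by blast
      moreover have "Q' \<subset> ext (contr Q)" using Q'(2) ext by simp
      moreover have "acc_on {I. saturated R (carrier R - contr Q) I}"
      proof (rule acc_on_subset[OF acc])
        have "contr Q \<subseteq> p"
          using contr_mono[OF Suc.prems(2)] contr_ext[OF primeD(1)[OF p]] by simp
        then have "carrier R - p \<subseteq> carrier R - contr Q" by blast
        then show "{I. saturated R (carrier R - contr Q) I} \<subseteq> {I. saturated R (carrier R - p) I}"
          using saturated_mono by blast
      qed
      ultimately obtain p'' where p'': "primeideal p'' R" "contr Q' \<subset> p''" "p'' \<subset> contr Q"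
        using prime_between[OF pQ _ pc' pQ'] by metis
      have "chain_to R (contr Q) (Suc (Suc (m - 1)))"
        by (rule chain_to_Suc[OF chain_to_Suc[OF IH(1) p''(1,2)] pQ p''(3)])
      \<comment> \<open>Here \<open>m = 0\<close> yields a chain that is one step too long, and it
        is shortened.\<close>
      then show ?thesis by (cases m) (auto intro: chain_to_less)
    qed
  qed
  ultimately show ?case by simp
qed

lemma chain_to_ext: "chain_to R p n \<Longrightarrow> chain_to P (ext p) n"
proof (induction n arbitrary: p)
  case 0
  then show ?case using chain_to_0[OF primeideal_ext[OF chain_to_prime]] by blast
next
  case (Suc n)
  have p: "primeideal p R" by (rule chain_to_prime[OF Suc.prems])
  from Suc.prems obtain q where q: "chain_to R q n" "q \<subset> p" by (rule chain_to_SucE)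
  show ?case
    by (rule chain_to_Suc[OF Suc.IH[OF q(1)] primeideal_ext[OF p]
        ext_less[OF primeD(1)[OF chain_to_prime[OF q(1)]] primeD(1)[OF p] q(2)]])
qed

theorem height_ext:
  assumes p: "primeideal p R" and acc: "acc_on {I. saturated R (carrier R - p) I}"
  shows "height P (ext p) = height R p"
proof -
  have "chain_to P (ext p) n \<longleftrightarrow> chain_to R p n" for n
    using chain_to_contr[OF p acc, of "ext p" n] chain_to_ext[of p n] contr_ext[OF primeD(1)[OF p]]
    by auto
  then show ?thesis unfolding height_alt by simp
qed

end

section \<open>Maximal \<open>q\<close>-ideals\<close>

context cring
begin

text \<open>Density of the ideal generated by \<open>F\<close>, expressed on the generators
  themselves; see \<open>dense_genideal_iff\<close>.\<close>

definition faithful :: "'a set \<Rightarrow> bool"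
  where "faithful F \<longleftrightarrow> (\<forall>a\<in>carrier R. (\<forall>x\<in>F. a \<otimes> x = \<zero>) \<longrightarrow> a = \<zero>)"

text \<open>The description of maximal \<open>q\<close>-ideals inside the ring;
  \<open>q_Max_eq\<close> proves that the two notions agree.\<close>

definition max_non_semi_regular :: "'a set \<Rightarrow> bool"
  where "max_non_semi_regular M \<longleftrightarrow> ideal M R \<and> \<not> semi_regular_ideal R M \<and>
    (\<forall>I. ideal I R \<and> \<not> semi_regular_ideal R I \<and> M \<subseteq> I \<longrightarrow> I = M)"

lemma ideal_mult_preimage:
  assumes I: "ideal I R" and a: "a \<in> carrier R"
  shows "ideal {x \<in> carrier R. x \<otimes> a \<in> I} R"
proof (rule ideal_cringI)
  note iI = idealD[OF I]
  show "\<zero> \<in> {x \<in> carrier R. x \<otimes> a \<in> I}" using iI(3) a by simp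
  show "x \<oplus> y \<in> {x \<in> carrier R. x \<otimes> a \<in> I}"
    if "x \<in> {x \<in> carrier R. x \<otimes> a \<in> I}" "y \<in> {x \<in> carrier R. x \<otimes> a \<in> I}" for x y
    using that iI(4) a by (simp add: l_distr)
  show "r \<otimes> x \<in> {x \<in> carrier R. x \<otimes> a \<in> I}"
    if "x \<in> {x \<in> carrier R. x \<otimes> a \<in> I}" "r \<in> carrier R" for x r
    using that iI(7) a by (simp add: m_assoc)
qed auto

lemma genideal_mult_mem:
  assumes "ideal I R" "a \<in> carrier R" "F \<subseteq> carrier R" "\<And>x. x \<in> F \<Longrightarrow> x \<otimes> a \<in> I" "x \<in> Idl F"
  shows "x \<otimes> a \<in> I"
  using genideal_minimal[OF ideal_mult_preimage[OF assms(1,2)], of F] assms(3-5) by blast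

lemma dense_genideal_iff:
  assumes "F \<subseteq> carrier R"
  shows "dense_ideal R (Idl F) \<longleftrightarrow> faithful F"
proof -
  have "(\<forall>x\<in>Idl F. a \<otimes> x = \<zero>) \<longleftrightarrow> (\<forall>x\<in>F. a \<otimes> x = \<zero>)" if a: "a \<in> carrier R" for a
  proof
    show "\<forall>x\<in>F. a \<otimes> x = \<zero>" if "\<forall>x\<in>Idl F. a \<otimes> x = \<zero>"
      using that genideal_self[OF assms] by blast
  next
    assume F: "\<forall>x\<in>F. a \<otimes> x = \<zero>"
    show "\<forall>x\<in>Idl F. a \<otimes> x = \<zero>"
    proof
      fix x assume x: "x \<in> Idl F"
      have "x \<otimes> a \<in> {\<zero>}"
      proof (rule genideal_mult_mem[OF zeroideal a assms _ x])
        fix y assume "y \<in> F"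
        then show "y \<otimes> a \<in> {\<zero>}" using F assms a m_comm[of y a] by auto
      qed
      moreover have "x \<in> carrier R" by (rule idealD(2)[OF genideal_ideal[OF assms] x])
      ultimately show "a \<otimes> x = \<zero>" using a m_comm[of x a] by simp
    qed
  qed
  then have "{a \<in> carrier R. \<forall>x\<in>Idl F. a \<otimes> x = \<zero>} = {a \<in> carrier R. \<forall>x\<in>F. a \<otimes> x = \<zero>}" by blast
  moreover have "\<zero> \<in> {a \<in> carrier R. \<forall>x\<in>F. a \<otimes> x = \<zero>}" using assms by auto
  ultimately show ?thesis
    unfolding dense_ideal_def faithful_def using genideal_ideal[OF assms] by auto
qed

lemma semi_regular_iff:
  "semi_regular_ideal R I \<longleftrightarrow> ideal I R \<and> (\<exists>F. finite F \<and> F \<subseteq> I \<and> faithful F)"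
proof
  assume I: "semi_regular_ideal R I"
  then obtain F where F: "finite F" "F \<subseteq> carrier R" "dense_ideal R (Idl F)" "Idl F \<subseteq> I" "ideal I R"
    unfolding semi_regular_ideal_def fin_gen_ideal_def by blast
  then show "ideal I R \<and> (\<exists>F. finite F \<and> F \<subseteq> I \<and> faithful F)"
    using dense_genideal_iff genideal_self[OF F(2)] by blast
next
  assume "ideal I R \<and> (\<exists>F. finite F \<and> F \<subseteq> I \<and> faithful F)"
  then obtain F where I: "ideal I R" and F: "finite F" "F \<subseteq> I" "faithful F" by blast
  have Fc: "F \<subseteq> carrier R" using F(2) idealD(1)[OF I] by blast
  then show "semi_regular_ideal R I"
    unfolding semi_regular_ideal_def fin_gen_ideal_def
    using I F(1) dense_genideal_iff[OF Fc] F(3) genideal_minimal[OF I F(2)] by blast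
qed

lemma faithful_mono: "faithful F \<Longrightarrow> F \<subseteq> G \<Longrightarrow> faithful G"
  unfolding faithful_def by blast

lemma faithful_one: "faithful {\<one>}"
  unfolding faithful_def by simp

text \<open>An ideal containing a dense ideal is itself dense, so a finitely generated semi-regular
  ideal is dense on its own generators.\<close>

lemma fin_gen_semi_regular_iff:
  "J \<in> fin_gen_semi_regular R \<longleftrightarrow> (\<exists>F. finite F \<and> F \<subseteq> carrier R \<and> faithful F \<and> J = Idl F)"
proof
  assume "J \<in> fin_gen_semi_regular R"
  then obtain F where F: "finite F" "F \<subseteq> carrier R" "J = Idl F" and J: "semi_regular_ideal R J"
    unfolding fin_gen_semi_regular_def fin_gen_ideal_def by blast
  then obtain G where "G \<subseteq> Idl F" "faithful G" using semi_regular_iff by blast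
  then have "faithful (Idl F)" using faithful_mono by blast
  then have "dense_ideal R (Idl F)"
    using genideal_ideal[OF F(2)] zeroideal unfolding dense_ideal_def faithful_def
    by (auto dest: idealD(2))
  then show "\<exists>F. finite F \<and> F \<subseteq> carrier R \<and> faithful F \<and> J = Idl F"
    using F dense_genideal_iff by blast
next
  assume "\<exists>F. finite F \<and> F \<subseteq> carrier R \<and> faithful F \<and> J = Idl F"
  then obtain F where F: "finite F" "F \<subseteq> carrier R" "faithful F" "J = Idl F" by blast
  then show "J \<in> fin_gen_semi_regular R"
    unfolding fin_gen_semi_regular_def fin_gen_ideal_def
    using semi_regular_iff[of J] genideal_ideal[OF F(2)] genideal_self[OF F(2)] by blast
qed

text \<open>Eliminates the envelope. On elements \<open>\<iota> a\<close> the module action is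
  multiplication in the ring, and \<open>J a \<subseteq> I\<close> need only be tested on generators
  of \<open>J\<close>. Taking \<open>F = {\<one>}\<close> shows that \<open>\<iota>\<close> maps
  \<open>I\<close> into its \<open>q_envelope\<close>.\<close>

lemma q_ideal_iff:
  assumes env: "injective_envelope R E \<iota>"
  shows "q_ideal R E \<iota> I \<longleftrightarrow> ideal I R \<and>
    (\<forall>F a. finite F \<and> F \<subseteq> carrier R \<and> faithful F \<and> a \<in> carrier R \<and> (\<forall>x\<in>F. x \<otimes> a \<in> I) \<longrightarrow> a \<in> I)"
    (is "_ \<longleftrightarrow> _ \<and> ?closed")
proof (cases "ideal I R")
  case False
  then show ?thesis unfolding q_ideal_def by simp
next
  case I: True
  note iI = idealD[OF I]
  have inj: "inj_on \<iota> (carrier R)" and hom: "\<iota> \<in> module_hom R (regular_module R) E"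
    using env unfolding injective_envelope_def by blast+
  have \<iota>: "\<iota> a \<in> carrier E" if "a \<in> carrier R" for a
    using hom that unfolding module_hom_def regular_module_def by auto
  have smult: "j \<odot>\<^bsub>E\<^esub> \<iota> a = \<iota> (j \<otimes> a)" if "j \<in> carrier R" "a \<in> carrier R" for j a
    using hom that unfolding module_hom_def regular_module_def by simp
  have mem: "\<iota> a \<in> \<iota> ` I \<longleftrightarrow> a \<in> I" if "a \<in> carrier R" for a
    using inj_on_image_mem_iff[OF inj that iI(1)] .
  have env_iff: "\<iota> a \<in> q_envelope R E \<iota> I \<longleftrightarrow>
      (\<exists>F. finite F \<and> F \<subseteq> carrier R \<and> faithful F \<and> (\<forall>x\<in>F. x \<otimes> a \<in> I))" (is "_ \<longleftrightarrow> ?ex")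
    if a: "a \<in> carrier R" for a
  proof
    assume "\<iota> a \<in> q_envelope R E \<iota> I"
    then obtain F where F: "finite F" "F \<subseteq> carrier R" "faithful F"
      and J: "\<forall>x\<in>Idl F. x \<odot>\<^bsub>E\<^esub> \<iota> a \<in> \<iota> ` I"
      unfolding q_envelope_def using fin_gen_semi_regular_iff by auto
    have "x \<otimes> a \<in> I" if "x \<in> F" for x
    proof -
      have "x \<in> carrier R" "x \<in> Idl F" using that F(2) genideal_self[OF F(2)] by auto
      then have "\<iota> (x \<otimes> a) \<in> \<iota> ` I" using J smult[of x a] a by metis
      then show ?thesis using mem[of "x \<otimes> a"] \<open>x \<in> carrier R\<close> a by simp
    qed
    then show ?ex using F by blast
  next
    assume ?ex
    then obtain F where F: "finite F" "F \<subseteq> carrier R" "faithful F" "\<And>x. x \<in> F \<Longrightarrow> x \<otimes> a \<in> I" by blast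
    have "x \<odot>\<^bsub>E\<^esub> \<iota> a \<in> \<iota> ` I" if x: "x \<in> Idl F" for x
      using genideal_mult_mem[OF I a F(2,4) x] smult[OF idealD(2)[OF genideal_ideal[OF F(2)] x] a]
      by simp
    then show "\<iota> a \<in> q_envelope R E \<iota> I"
      unfolding q_envelope_def using fin_gen_semi_regular_iff F(1-3) \<iota>[OF a] by blast
  qed
  have one: "\<iota> a \<in> q_envelope R E \<iota> I" if "a \<in> I" for a
  proof -
    have "finite {\<one>}" "{\<one>} \<subseteq> carrier R" "\<forall>x\<in>{\<one>}. x \<otimes> a \<in> I" using that iI(2) by auto
    then show ?thesis using env_iff[OF iI(2)[OF that]] faithful_one by blast
  qed
  have "q_envelope R E \<iota> I \<inter> \<iota> ` carrier R = \<iota> ` I \<longleftrightarrow>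
      (\<forall>a\<in>carrier R. \<iota> a \<in> q_envelope R E \<iota> I \<longrightarrow> a \<in> I)" (is "?l \<longleftrightarrow> ?r")
  proof
    assume ?l
    then show ?r using mem by blast
  next
    assume ?r
    show ?l
    proof
      show "q_envelope R E \<iota> I \<inter> \<iota> ` carrier R \<subseteq> \<iota> ` I" using \<open>?r\<close> by blast
      show "\<iota> ` I \<subseteq> q_envelope R E \<iota> I \<inter> \<iota> ` carrier R" using one iI(2) by blast
    qed
  qed
  also have "\<dots> \<longleftrightarrow> ?closed" using env_iff by blast
  finally show ?thesis unfolding q_ideal_def using I by blast
qed

section \<open>Ideals maximal among the non-semi-regular ones\<close>

lemma max_non_semi_regularD:
  assumes "max_non_semi_regular M"
  shows "ideal M R" "\<not> semi_regular_ideal R M"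
    "\<And>I. ideal I R \<Longrightarrow> \<not> semi_regular_ideal R I \<Longrightarrow> M \<subseteq> I \<Longrightarrow> I = M"
  using assms unfolding max_non_semi_regular_def by blast+

lemma non_semi_regular_one:
  assumes "ideal I R" "\<not> semi_regular_ideal R I"
  shows "\<one> \<notin> I"
proof
  assume "\<one> \<in> I"
  then have "finite {\<one>} \<and> {\<one>} \<subseteq> I \<and> faithful {\<one>}" using faithful_one by simp
  then show False using assms semi_regular_iff by blast
qed

text \<open>Zorn's lemma applies because semi-regularity is witnessed by a finite set: a witness in
  the union of a chain already lies in one member.\<close>

lemma max_non_semi_regular_exists:
  assumes I: "ideal I R" "\<not> semi_regular_ideal R I"
  obtains M where "max_non_semi_regular M" "I \<subseteq> M"
proof -
  let ?A = "{J. ideal J R \<and> \<not> semi_regular_ideal R J \<and> I \<subseteq> J}"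
  have "\<exists>M\<in>?A. \<forall>X\<in>?A. M \<subseteq> X \<longrightarrow> X = M"
  proof (rule subset_Zorn_nonempty)
    show "?A \<noteq> {}" using I by blast
  next
    fix C assume ne: "C \<noteq> {}" and chain: "subset.chain ?A C"
    have C: "\<And>J. J \<in> C \<Longrightarrow> ideal J R \<and> \<not> semi_regular_ideal R J \<and> I \<subseteq> J"
      using chain unfolding subset.chain_def by blast
    have tot: "J \<subseteq> K \<or> K \<subseteq> J" if "J \<in> C" "K \<in> C" for J K
      using chain that unfolding subset_chain_def by blast
    have U: "ideal (\<Union>C) R"
    proof (rule ideal_cringI)
      show "\<Union>C \<subseteq> carrier R" using C idealD(1) by blast
      show "\<zero> \<in> \<Union>C" using ne C idealD(3) by blast
    next
      fix x y assume "x \<in> \<Union>C" "y \<in> \<Union>C"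
      then obtain J K where JK: "J \<in> C" "K \<in> C" "x \<in> J" "y \<in> K" by blast
      show "x \<oplus> y \<in> \<Union>C"
      proof (cases "J \<subseteq> K")
        case True
        then have "x \<oplus> y \<in> K" using idealD(4)[of K R x y] C[OF JK(2)] JK by blast
        then show ?thesis using JK by blast
      next
        case False
        then have "x \<oplus> y \<in> J" using idealD(4)[of J R x y] C[OF JK(1)] JK tot[OF JK(1,2)] by blast
        then show ?thesis using JK by blast
      qed
    next
      fix r x assume r: "r \<in> carrier R" and "x \<in> \<Union>C"
      then obtain J where J: "J \<in> C" "x \<in> J" by blast
      then have "r \<otimes> x \<in> J" using idealD(7)[of J R x r] C[OF J(1)] r by blast
      then show "r \<otimes> x \<in> \<Union>C" using J by blast
    qed
    moreover have "\<not> semi_regular_ideal R (\<Union>C)"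
    proof
      assume "semi_regular_ideal R (\<Union>C)"
      then obtain F where F: "finite F" "F \<subseteq> \<Union>C" "faithful F" using semi_regular_iff by blast
      obtain J where "J \<in> C" "F \<subseteq> J"
        using finite_subset_Union_chain[OF F(1,2) ne chain] by blast
      then show False using C[of J] F semi_regular_iff by blast
    qed
    moreover have "I \<subseteq> \<Union>C" using ne C by blast
    ultimately show "\<Union>C \<in> ?A" by blast
  qed
  then obtain M where M: "M \<in> ?A" and max: "\<forall>X\<in>?A. M \<subseteq> X \<longrightarrow> X = M" by blast
  have "max_non_semi_regular M" unfolding max_non_semi_regular_def
  proof (intro conjI allI impI)
    show "ideal M R" "\<not> semi_regular_ideal R M" using M by simp_all
    fix J assume J: "ideal J R \<and> \<not> semi_regular_ideal R J \<and> M \<subseteq> J"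
    then have "J \<in> ?A" using M by blast
    then show "J = M" using max J by blast
  qed
  moreover have "I \<subseteq> M" using M by simp
  ultimately show thesis by (rule that)
qed

text \<open>If \<open>a\<close> and \<open>b\<close> are outside \<open>M\<close>, then
  \<open>add_mults M a\<close> and \<open>add_mults M b\<close> contain finite faithful sets
  \<open>F\<close> and \<open>G\<close>. Their products form a finite faithful set, which lies in
  \<open>M\<close> as soon as \<open>a \<otimes> b\<close> does.\<close>

lemma max_non_semi_regular_prime:
  assumes M: "max_non_semi_regular M"
  shows "primeideal M R"
proof (rule primeideal_cringI)
  note M' = max_non_semi_regularD[OF M]
  note iM = idealD[OF M'(1)]
  show "ideal M R" by (rule M'(1))
  show "\<one> \<notin> M" by (rule non_semi_regular_one[OF M'(1,2)])
  have semi: "\<exists>F. finite F \<and> F \<subseteq> add_mults M a \<and> faithful F" if a: "a \<in> carrier R" "a \<notin> M" for a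
  proof -
    note aM = ideal_add_mults[OF M'(1) a(1)]
    have "semi_regular_ideal R (add_mults M a)" using M'(3)[OF aM(1)] aM(2,3) a(2) by blast
    then show ?thesis using semi_regular_iff by blast
  qed
  fix a b assume ab: "a \<in> carrier R" "b \<in> carrier R" "a \<otimes> b \<in> M"
  show "a \<in> M \<or> b \<in> M"
  proof (rule ccontr)
    assume "\<not> (a \<in> M \<or> b \<in> M)"
    then obtain F G where F: "finite F" "F \<subseteq> add_mults M a" "faithful F"
      and G: "finite G" "G \<subseteq> add_mults M b" "faithful G" using semi[OF ab(1)] semi[OF ab(2)] by blast
    have Fc: "x \<in> carrier R" if "x \<in> F" for x
      using F(2) that idealD(2)[OF ideal_add_mults(1)[OF M'(1) ab(1)]] by blast
    have Gc: "x \<in> carrier R" if "x \<in> G" for x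
      using G(2) that idealD(2)[OF ideal_add_mults(1)[OF M'(1) ab(2)]] by blast
    let ?H = "(\<lambda>(x, y). x \<otimes> y) ` (F \<times> G)"
    have "?H \<subseteq> M"
    proof clarify
      fix x y assume xy: "x \<in> F" "y \<in> G"
      obtain i r where x: "i \<in> M" "r \<in> carrier R" "x = i \<oplus> r \<otimes> a"
        using F(2) xy(1) unfolding add_mults_def by blast
      obtain j t where y: "j \<in> M" "t \<in> carrier R" "y = j \<oplus> t \<otimes> b"
        using G(2) xy(2) unfolding add_mults_def by blast
      have ij: "i \<in> carrier R" "j \<in> carrier R" using iM(2) x(1) y(1) by auto
      have "x \<otimes> y = i \<otimes> y \<oplus> ((r \<otimes> a) \<otimes> j \<oplus> (r \<otimes> t) \<otimes> (a \<otimes> b))"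
        unfolding x(3) y(3) using ij x(2) y(2) ab(1,2) by (simp add: l_distr r_distr m_ac a_ac)
      also have "\<dots> \<in> M"
        using x(1,2) y(1,2) ab Gc[OF xy(2)] by (intro iM(4)) (auto intro: iM(7,8))
      finally show "x \<otimes> y \<in> M" .
    qed
    moreover have "faithful ?H" unfolding faithful_def
    proof (intro ballI impI)
      fix c assume c: "c \<in> carrier R" "\<forall>x\<in>?H. c \<otimes> x = \<zero>"
      have "c \<otimes> x = \<zero>" if x: "x \<in> F" for x
      proof -
        have "(c \<otimes> x) \<otimes> y = \<zero>" if y: "y \<in> G" for y
        proof -
          have "c \<otimes> (x \<otimes> y) = \<zero>" using c(2) x y by simp
          then show ?thesis using c(1) Fc[OF x] Gc[OF y] by (simp add: m_assoc)
        qed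
        then show ?thesis using G(3) c(1) Fc[OF x] unfolding faithful_def by simp
      qed
      then show "c = \<zero>" using F(3) c(1) unfolding faithful_def by simp
    qed
    moreover have "finite ?H" using F(1) G(1) by simp
    ultimately show False using M'(1,2) semi_regular_iff by blast
  qed
qed

text \<open>A finite faithful set cannot lie inside \<open>p\<close>, so it has a member outside
  \<open>p\<close>, which saturation cancels. Through this lemma the chain condition on
  \<open>q\<close>-ideals becomes the noetherian property at \<open>p\<close>.\<close>

lemma saturated_imp_q_ideal:
  assumes env: "injective_envelope R E \<iota>" and p: "ideal p R" "\<not> semi_regular_ideal R p"
    and I: "saturated R (carrier R - p) I"
  shows "q_ideal R E \<iota> I"
  unfolding q_ideal_iff[OF env]
proof (intro conjI allI impI)
  show "ideal I R" by (rule saturatedD(1)[OF I])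
  fix F a
  assume F: "finite F \<and> F \<subseteq> carrier R \<and> faithful F \<and> a \<in> carrier R \<and> (\<forall>x\<in>F. x \<otimes> a \<in> I)"
  then have "\<not> F \<subseteq> p" using p semi_regular_iff by blast
  then obtain s where s: "s \<in> F" "s \<notin> p" by blast
  then show "a \<in> I" using saturatedD(2)[OF I, of s a] F by blast
qed

text \<open>A \<open>q\<close>-ideal containing a finite faithful set contains
  \<open>\<one>\<close>, so proper \<open>q\<close>-ideals are not semi-regular. Conversely, a
  maximal non-semi-regular ideal is prime, hence saturated for its own complement, hence a
  \<open>q\<close>-ideal.\<close>

theorem q_Max_eq:
  assumes env: "injective_envelope R E \<iota>"
  shows "q_Max R E \<iota> = {M. max_non_semi_regular M}"
proof -
  have non_semi: "ideal I R \<and> \<not> semi_regular_ideal R I" if I: "q_ideal R E \<iota> I" "I \<noteq> carrier R" for I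
  proof -
    have i: "ideal I R" using I(1) unfolding q_ideal_def by blast
    moreover have "\<not> semi_regular_ideal R I"
    proof
      assume "semi_regular_ideal R I"
      then obtain F where F: "finite F" "F \<subseteq> I" "faithful F" using semi_regular_iff by blast
      then have Fc: "F \<subseteq> carrier R" using idealD(1)[OF i] by blast
      have "\<forall>x\<in>F. x \<otimes> \<one> \<in> I"
      proof
        fix x assume "x \<in> F"
        then have "x \<in> I" "x \<in> carrier R" using F(2) Fc by auto
        then show "x \<otimes> \<one> \<in> I" by simp
      qed
      then have "\<one> \<in> I" using I(1)[unfolded q_ideal_iff[OF env]] F Fc by blast
      then show False using I(2) ideal.one_imp_carrier[OF i] by blast
    qed
    ultimately show ?thesis by blast
  qed
  have q: "q_ideal R E \<iota> M \<and> M \<noteq> carrier R" if M: "max_non_semi_regular M" for M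
  proof -
    note M' = max_non_semi_regularD[OF M]
    have p: "primeideal M R" by (rule max_non_semi_regular_prime[OF M])
    show ?thesis
      using saturated_imp_q_ideal[OF env M'(1,2) saturated_prime[OF p order_refl]] primeD(5)[OF p]
      by blast
  qed
  show ?thesis
  proof (intro equalityI subsetI)
    fix M assume M: "M \<in> q_Max R E \<iota>"
    then have M1: "q_ideal R E \<iota> M" "M \<noteq> carrier R"
      and max: "\<And>I. q_ideal R E \<iota> I \<Longrightarrow> I \<noteq> carrier R \<Longrightarrow> M \<subseteq> I \<Longrightarrow> I = M"
      unfolding q_Max_def by blast+
    obtain N where N: "max_non_semi_regular N" "M \<subseteq> N"
      using max_non_semi_regular_exists non_semi[OF M1] by blast
    then show "M \<in> {M. max_non_semi_regular M}" using max[of N] q[OF N(1)] by simp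
  next
    fix M assume "M \<in> {M. max_non_semi_regular M}"
    then have M: "max_non_semi_regular M" by simp
    show "M \<in> q_Max R E \<iota>"
      unfolding q_Max_def using q[OF M] non_semi max_non_semi_regularD(3)[OF M] by blast
  qed
qed

end

section \<open>Primes of the total quotient ring\<close>

context cring
begin

abbreviation Q_ring :: "('a \<times> 'a) set ring"
  where "Q_ring \<equiv> total_quotient_ring R"

definition tq_ext :: "'a set \<Rightarrow> ('a \<times> 'a) set set"
  where "tq_ext q = {fraction R a s | a s. a \<in> q \<and> s \<in> regular_elements R}"

definition tq_contr :: "('a \<times> 'a) set set \<Rightarrow> 'a set"
  where "tq_contr \<qq> = {a \<in> carrier R. fraction R a \<one> \<in> \<qq>}"

lemmas tq_simps = fraction_closed mult_fraction add_fraction zero_total one_total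
  one_regular mult_regular regular_elementsD(1)

text \<open>The numerator decides membership whichever representative is chosen: denominators avoid
  the prime \<open>q\<close> and can be cancelled.\<close>

lemma fraction_mem_tq_ext:
  assumes q: "primeideal q R" "q \<inter> regular_elements R = {}"
    and a: "a \<in> carrier R" "s \<in> regular_elements R"
  shows "fraction R a s \<in> tq_ext q \<longleftrightarrow> a \<in> q"
proof
  assume "fraction R a s \<in> tq_ext q"
  then obtain b t where b: "b \<in> q" "t \<in> regular_elements R" "fraction R a s = fraction R b t"
    unfolding tq_ext_def by blast
  note iq = idealD[OF primeD(1)[OF q(1)]]
  have "a \<otimes> t = b \<otimes> s" using fraction_eq_iff[OF a(1) iq(2)[OF b(1)] a(2) b(2)] b(3) by simp
  also have "\<dots> \<in> q" using b(1) a(2) by (intro iq(8)) (auto dest: regular_elementsD)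
  finally show "a \<in> q" using primeD(3)[OF q(1) a(1), of t] b(2) q(2) regular_elementsD(1) by blast
qed (use a in \<open>auto simp: tq_ext_def\<close>)

lemma primeideal_tq_ext:
  assumes q: "primeideal q R" "q \<inter> regular_elements R = {}"
  shows "primeideal (tq_ext q) Q_ring"
proof -
  interpret T: cring Q_ring by (rule cring_total_quotient_ring)
  note iq = idealD[OF primeD(1)[OF q(1)]]
  note mem = fraction_mem_tq_ext[OF q]
  have cases: thesis if "X \<in> tq_ext q"
    "\<And>a s. a \<in> q \<Longrightarrow> a \<in> carrier R \<Longrightarrow> s \<in> regular_elements R \<Longrightarrow> X = fraction R a s \<Longrightarrow> thesis" for X thesis
    using that iq(2) unfolding tq_ext_def by blast
  show ?thesis
  proof (rule T.primeideal_cringI)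
    show "ideal (tq_ext q) Q_ring"
    proof (rule T.ideal_cringI)
      show "tq_ext q \<subseteq> carrier Q_ring" unfolding tq_ext_def using fraction_closed iq(2) by blast
      show "\<zero>\<^bsub>Q_ring\<^esub> \<in> tq_ext q" using mem iq(3) by (simp add: tq_simps)
    next
      fix X Y assume "X \<in> tq_ext q" "Y \<in> tq_ext q"
      then obtain a s b t where ab: "a \<in> q" "a \<in> carrier R" "s \<in> regular_elements R" "X = fraction R a s"
        "b \<in> q" "b \<in> carrier R" "t \<in> regular_elements R" "Y = fraction R b t"
        by (elim cases) blast
      then have "a \<otimes> t \<oplus> b \<otimes> s \<in> q" by (intro iq(4,8)) (auto dest: regular_elementsD)
      then show "X \<oplus>\<^bsub>Q_ring\<^esub> Y \<in> tq_ext q" using ab mem by (simp add: tq_simps)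
    next
      fix X Y assume "Y \<in> tq_ext q" "X \<in> carrier Q_ring"
      then obtain a s b t where ab: "a \<in> carrier R" "s \<in> regular_elements R" "X = fraction R a s"
        "b \<in> q" "b \<in> carrier R" "t \<in> regular_elements R" "Y = fraction R b t"
        by (elim cases fraction_cases) blast
      then have "a \<otimes> b \<in> q" by (intro iq(7))
      then show "X \<otimes>\<^bsub>Q_ring\<^esub> Y \<in> tq_ext q" using ab mem by (simp add: tq_simps)
    qed
    show "\<one>\<^bsub>Q_ring\<^esub> \<notin> tq_ext q" using mem primeD(2)[OF q(1)] by (simp add: tq_simps)
  next
    fix X Y assume XY: "X \<in> carrier Q_ring" "Y \<in> carrier Q_ring" "X \<otimes>\<^bsub>Q_ring\<^esub> Y \<in> tq_ext q"
    then obtain a s b t where ab: "a \<in> carrier R" "s \<in> regular_elements R" "X = fraction R a s"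
      "b \<in> carrier R" "t \<in> regular_elements R" "Y = fraction R b t"
      by (elim fraction_cases) blast
    then have "a \<otimes> b \<in> q" using XY(3) mem by (simp add: tq_simps)
    then show "X \<in> tq_ext q \<or> Y \<in> tq_ext q" using primeD(3)[OF q(1)] ab mem by simp
  qed
qed

lemma primeideal_tq_contr:
  assumes q: "primeideal \<qq> Q_ring"
  shows "primeideal (tq_contr \<qq>) R" "tq_contr \<qq> \<inter> regular_elements R = {}"
proof -
  note iq = idealD[OF primeD(1)[OF q]]
  show "primeideal (tq_contr \<qq>) R"
  proof (rule primeideal_cringI)
    show "ideal (tq_contr \<qq>) R"
    proof (rule ideal_cringI)
      show "tq_contr \<qq> \<subseteq> carrier R" by (auto simp: tq_contr_def)
      show "\<zero> \<in> tq_contr \<qq>" using iq(3) by (simp add: tq_contr_def tq_simps)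
      show "x \<oplus> y \<in> tq_contr \<qq>" if "x \<in> tq_contr \<qq>" "y \<in> tq_contr \<qq>" for x y
        using that iq(4)[of "fraction R x \<one>" "fraction R y \<one>"]
        by (simp add: tq_contr_def tq_simps)
      show "r \<otimes> x \<in> tq_contr \<qq>" if "x \<in> tq_contr \<qq>" "r \<in> carrier R" for x r
        using that iq(7)[of "fraction R x \<one>" "fraction R r \<one>"]
        by (simp add: tq_contr_def tq_simps)
    qed
    show "\<one> \<notin> tq_contr \<qq>" using primeD(2)[OF q] by (simp add: tq_contr_def tq_simps)
    show "a \<in> tq_contr \<qq> \<or> b \<in> tq_contr \<qq>"
      if "a \<in> carrier R" "b \<in> carrier R" "a \<otimes> b \<in> tq_contr \<qq>" for a b
      using that primeD(3)[OF q, of "fraction R a \<one>" "fraction R b \<one>"]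
      by (simp add: tq_contr_def tq_simps)
  qed
  show "tq_contr \<qq> \<inter> regular_elements R = {}"
  proof (rule ccontr)
    assume "tq_contr \<qq> \<inter> regular_elements R \<noteq> {}"
    then obtain s where s: "s \<in> regular_elements R" "fraction R s \<one> \<in> \<qq>" "s \<in> carrier R"
      by (auto simp: tq_contr_def)
    have "fraction R \<one> s \<otimes>\<^bsub>Q_ring\<^esub> fraction R s \<one> \<in> \<qq>" using s by (intro iq(7)) (auto simp: tq_simps)
    moreover have "fraction R \<one> s \<otimes>\<^bsub>Q_ring\<^esub> fraction R s \<one> = \<one>\<^bsub>Q_ring\<^esub>"
      using s fraction_eq_iff[of s \<one> s \<one>] by (simp add: tq_simps)
    ultimately show False using primeD(2)[OF q] by simp
  qed
qed

text \<open>A fraction and its numerator differ by a unit of the total quotient ring, so a fraction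
  separating the two ideals has a separating numerator.\<close>

lemma tq_contr_less:
  assumes q: "ideal \<qq> Q_ring" "ideal \<qq>' Q_ring" and less: "\<qq> \<subset> \<qq>'"
  shows "tq_contr \<qq> \<subset> tq_contr \<qq>'"
proof -
  obtain X where X: "X \<in> \<qq>'" "X \<notin> \<qq>" using less by blast
  obtain a s where a: "a \<in> carrier R" "s \<in> regular_elements R" "X = fraction R a s"
    using fraction_cases[OF idealD(2)[OF q(2) X(1)]] by blast
  have sc: "s \<in> carrier R" using a(2) by (rule regular_elementsD)
  have "fraction R s \<one> \<otimes>\<^bsub>Q_ring\<^esub> X \<in> \<qq>'" using X(1) sc by (intro idealD(7)[OF q(2)]) (auto simp: tq_simps)
  moreover have "fraction R s \<one> \<otimes>\<^bsub>Q_ring\<^esub> X = fraction R a \<one>"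
    using a sc fraction_eq_iff[of "s \<otimes> a" a s \<one>] by (simp add: tq_simps m_comm)
  ultimately have "a \<in> tq_contr \<qq>'" using a by (simp add: tq_contr_def)
  moreover have "a \<notin> tq_contr \<qq>"
  proof
    assume "a \<in> tq_contr \<qq>"
    then have "fraction R \<one> s \<otimes>\<^bsub>Q_ring\<^esub> fraction R a \<one> \<in> \<qq>"
      using a by (intro idealD(7)[OF q(1)]) (auto simp: tq_simps tq_contr_def)
    then show False using a X(2) sc by (simp add: tq_simps)
  qed
  ultimately show ?thesis using less by (auto simp: tq_contr_def)
qed

lemma tq_ext_less:
  assumes q: "primeideal q R" "primeideal q' R" "q' \<inter> regular_elements R = {}" and less: "q \<subset> q'"
  shows "tq_ext q \<subset> tq_ext q'"
proof -
  obtain a where a: "a \<in> q'" "a \<notin> q" using less by blast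
  have ac: "a \<in> carrier R" by (rule idealD(2)[OF primeD(1)[OF q(2)] a(1)])
  have "q \<inter> regular_elements R = {}" using q(3) less by blast
  then have "fraction R a \<one> \<in> tq_ext q' - tq_ext q"
    using fraction_mem_tq_ext[OF q(2,3) ac one_regular] fraction_mem_tq_ext[OF q(1) _ ac one_regular] a
    by simp
  moreover have "tq_ext q \<subseteq> tq_ext q'" using less unfolding tq_ext_def by blast
  ultimately show ?thesis by blast
qed

lemma chain_to_tq_contr: "chain_to Q_ring \<qq> n \<Longrightarrow> chain_to R (tq_contr \<qq>) n"
proof (induction n arbitrary: \<qq>)
  case 0
  then show ?case using chain_to_0[OF primeideal_tq_contr(1)[OF chain_to_prime]] by blast
next
  case (Suc n)
  have q: "primeideal \<qq> Q_ring" by (rule chain_to_prime[OF Suc.prems])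
  from Suc.prems obtain \<rr> where r: "chain_to Q_ring \<rr> n" "\<rr> \<subset> \<qq>" by (rule chain_to_SucE)
  show ?case
    by (rule chain_to_Suc[OF Suc.IH[OF r(1)] primeideal_tq_contr(1)[OF q]
        tq_contr_less[OF primeD(1)[OF chain_to_prime[OF r(1)]] primeD(1)[OF q] r(2)]])
qed

lemma chain_to_tq_ext:
  "chain_to R q n \<Longrightarrow> q \<inter> regular_elements R = {} \<Longrightarrow> chain_to Q_ring (tq_ext q) n"
proof (induction n arbitrary: q)
  case 0
  then show ?case using chain_to_0[OF primeideal_tq_ext[OF chain_to_prime]] by blast
next
  case (Suc n)
  have q: "primeideal q R" by (rule chain_to_prime[OF Suc.prems(1)])
  from Suc.prems(1) obtain r where r: "chain_to R r n" "r \<subset> q" by (rule chain_to_SucE)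
  have disj: "r \<inter> regular_elements R = {}" using Suc.prems(2) r(2) by blast
  show ?case
    by (rule chain_to_Suc[OF Suc.IH[OF r(1) disj] primeideal_tq_ext[OF q Suc.prems(2)]
        tq_ext_less[OF chain_to_prime[OF r(1)] q Suc.prems(2) r(2)]])
qed

text \<open>Only the top prime of a chain has to avoid the regular elements; the primes below it
  then avoid them too.\<close>

theorem krull_dim_total_quotient_ring:
  "krull_dim Q_ring = Sup {enat n | n. \<exists>q. chain_to R q n \<and> q \<inter> regular_elements R = {}}"
proof -
  have "(\<exists>C. prime_chain Q_ring C n) \<longleftrightarrow> (\<exists>\<qq>. chain_to Q_ring \<qq> n)" for n
    unfolding chain_to_def by blast
  moreover have "\<dots> n \<longleftrightarrow> (\<exists>q. chain_to R q n \<and> q \<inter> regular_elements R = {})" for n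
    using chain_to_tq_ext chain_to_tq_contr primeideal_tq_contr(2)[OF chain_to_prime] by blast
  ultimately show ?thesis unfolding krull_dim_def by simp
qed

end

section \<open>McCoy's theorem and semi-regular ideals of the polynomial ring\<close>

context UP_cring
begin

lemma coeff_mult_zero:
  assumes "f \<in> carrier P" "g \<in> carrier P" "\<And>j. j \<le> n \<Longrightarrow> coeff P f j \<otimes> coeff P g (n - j) = \<zero>"
  shows "coeff P (f \<otimes>\<^bsub>P\<^esub> g) n = \<zero>"
proof -
  have "(\<Oplus>j\<in>{..n}. coeff P f j \<otimes> coeff P g (n - j)) \<in> {\<zero>}"
    using assms(3) by (intro R.finsum_in_ideal[OF R.zeroideal]) simp_all
  then show ?thesis using assms(1,2) by simp
qed

theorem mccoy:
  assumes f: "f \<in> carrier P" "f \<notin> regular_elements P"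
  obtains r where "r \<in> carrier R" "r \<noteq> \<zero>" "\<And>n. r \<otimes> coeff P f n = \<zero>"
proof -
  define B where "B N \<longleftrightarrow> (\<exists>g\<in>carrier P. g \<otimes>\<^bsub>P\<^esub> f = \<zero>\<^bsub>P\<^esub> \<and> g \<noteq> \<zero>\<^bsub>P\<^esub> \<and> (\<forall>m\<ge>N. coeff P g m = \<zero>))" for N
  obtain g0 where g0: "g0 \<in> carrier P" "g0 \<otimes>\<^bsub>P\<^esub> f = \<zero>\<^bsub>P\<^esub>" "g0 \<noteq> \<zero>\<^bsub>P\<^esub>"
    using f unfolding regular_elements_def by blast
  have "B (Suc (deg R g0))" unfolding B_def
    using g0 deg_aboveD[OF _ g0(1)] by (intro bexI[of _ g0]) auto
  then have "\<exists>N. B N" by blast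
  from ex_min_nat[OF this] obtain N where "B N" and least: "\<forall>m. B m \<longrightarrow> N \<le> m" by blast
  then obtain g where g: "g \<in> carrier P" "g \<otimes>\<^bsub>P\<^esub> f = \<zero>\<^bsub>P\<^esub>" "g \<noteq> \<zero>\<^bsub>P\<^esub>" "\<forall>m\<ge>N. coeff P g m = \<zero>"
    unfolding B_def by blast
  have "N \<noteq> 0"
  proof
    assume "N = 0"
    then have "g = \<zero>\<^bsub>P\<^esub>" using g by (intro up_eqI) auto
    then show False using g(3) by simp
  qed
  then obtain d where d: "N = Suc d" by (cases N) auto
  have low: "h = \<zero>\<^bsub>P\<^esub>"
    if h: "h \<in> carrier P" "h \<otimes>\<^bsub>P\<^esub> f = \<zero>\<^bsub>P\<^esub>" "\<And>m. m \<ge> d \<Longrightarrow> coeff P h m = \<zero>" for h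
  proof (rule ccontr)
    assume "h \<noteq> \<zero>\<^bsub>P\<^esub>"
    then have "B d" unfolding B_def using h by blast
    then show False using least d by auto
  qed
  have kill: "coeff P f i \<odot>\<^bsub>P\<^esub> g = \<zero>\<^bsub>P\<^esub>" for i
  proof (induction i rule: measure_induct_rule[of "\<lambda>i. Suc (deg R f) - i"])
    case (less i)
    show ?case
    proof (cases "i \<le> deg R f")
      case False
      then show ?thesis using deg_aboveD[OF _ f(1), of i] g(1) by simp
    next
      case True
      have above: "coeff P f k \<otimes> coeff P g j = \<zero>" if "k > i" for k j
      proof -
        have "coeff P f k \<odot>\<^bsub>P\<^esub> g = \<zero>\<^bsub>P\<^esub>" using less[of k] that True by simp
        then have "coeff P (coeff P f k \<odot>\<^bsub>P\<^esub> g) j = \<zero>" by simp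
        then show ?thesis using f(1) g(1) by simp
      qed
      have top: "coeff P g d \<otimes> coeff P f i = \<zero>"
      proof -
        let ?t = "\<lambda>j. coeff P g j \<otimes> coeff P f (d + i - j)"
        let ?A = "{..d + i} - {d}"
        have t: "?t j \<in> {\<zero>}" if "j \<in> ?A" for j
        proof (cases "j > d")
          case True
          then show ?thesis using g(1,4) f(1) d by simp
        next
          case False
          then have "d + i - j > i" using that by auto
          then show ?thesis using above[of "d + i - j" j] f(1) g(1) by (simp add: R.m_comm)
        qed
        have "(\<Oplus>j\<in>?A. ?t j) \<in> {\<zero>}"
          by (rule R.finsum_in_ideal[OF R.zeroideal]) (simp, rule t)
        moreover have "coeff P (g \<otimes>\<^bsub>P\<^esub> f) (d + i) = ?t d \<oplus> (\<Oplus>j\<in>?A. ?t j)"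
        proof -
          have "{..d + i} = insert d ?A" by auto
          then have "coeff P (g \<otimes>\<^bsub>P\<^esub> f) (d + i) = (\<Oplus>j\<in>insert d ?A. ?t j)" using f(1) g(1) by simp
          also have "\<dots> = ?t d \<oplus> (\<Oplus>j\<in>?A. ?t j)" using f(1) g(1) by (subst R.finsum_insert) auto
          finally show ?thesis .
        qed
        moreover have "coeff P (g \<otimes>\<^bsub>P\<^esub> f) (d + i) = \<zero>" unfolding g(2) by simp
        ultimately show ?thesis using f(1) g(1) by simp
      qed
      show ?thesis
      proof (rule low)
        show "coeff P f i \<odot>\<^bsub>P\<^esub> g \<in> carrier P" using f(1) g(1) by simp
        have "(coeff P f i \<odot>\<^bsub>P\<^esub> g) \<otimes>\<^bsub>P\<^esub> f = coeff P f i \<odot>\<^bsub>P\<^esub> (g \<otimes>\<^bsub>P\<^esub> f)"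
          using f(1) g(1) by (simp add: UP_smult_assoc2)
        then show "(coeff P f i \<odot>\<^bsub>P\<^esub> g) \<otimes>\<^bsub>P\<^esub> f = \<zero>\<^bsub>P\<^esub>"
          unfolding g(2) using f(1) by (simp add: monom_mult_is_smult[symmetric])
        show "coeff P (coeff P f i \<odot>\<^bsub>P\<^esub> g) m = \<zero>" if "m \<ge> d" for m
          using that top g(1,4) f(1) d by (cases "m = d") (simp_all add: R.m_comm)
      qed
    qed
  qed
  show thesis
  proof (rule that)
    show "coeff P g d \<in> carrier R" using g(1) by simp
    show "coeff P g d \<noteq> \<zero>"
    proof
      assume "coeff P g d = \<zero>"
      then have "\<And>m. m \<ge> d \<Longrightarrow> coeff P g m = \<zero>" using g(4) d by (metis Suc_leI le_neq_implies_less)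
      then show False using low[OF g(1,2)] g(3) by simp
    qed
    fix n
    have "coeff P (coeff P f n \<odot>\<^bsub>P\<^esub> g) d = \<zero>" unfolding kill by simp
    then show "coeff P g d \<otimes> coeff P f n = \<zero>" using f(1) g(1) by (simp add: R.m_comm)
  qed
qed

lemma regular_UP_iff:
  assumes f: "f \<in> carrier P"
  shows "f \<in> regular_elements P \<longleftrightarrow> R.faithful (range (coeff P f))"
proof
  assume reg: "f \<in> regular_elements P"
  show "R.faithful (range (coeff P f))" unfolding R.faithful_def
  proof (intro ballI impI)
    fix a assume a: "a \<in> carrier R" "\<forall>x\<in>range (coeff P f). a \<otimes> x = \<zero>"
    then have "a \<odot>\<^bsub>P\<^esub> f = \<zero>\<^bsub>P\<^esub>" using f by (intro up_eqI) auto
    then have "monom P a 0 = \<zero>\<^bsub>P\<^esub>"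
      using P.regular_elementsD(2)[OF reg, of "monom P a 0"] a(1) f by (simp add: monom_mult_is_smult)
    then have "coeff P (monom P a 0) 0 = \<zero>" by simp
    then show "a = \<zero>" using a(1) by simp
  qed
next
  assume F: "R.faithful (range (coeff P f))"
  show "f \<in> regular_elements P"
  proof (rule ccontr)
    assume "f \<notin> regular_elements P"
    then obtain r where "r \<in> carrier R" "r \<noteq> \<zero>" "\<And>n. r \<otimes> coeff P f n = \<zero>" by (rule mccoy[OF f]) blast
    then show False using F unfolding R.faithful_def by blast
  qed
qed

lemma finite_range_coeff:
  assumes "f \<in> carrier P"
  shows "finite (range (coeff P f))"
proof (rule finite_subset)
  show "range (coeff P f) \<subseteq> insert \<zero> (coeff P f ` {..deg R f})"
  proof
    fix x assume "x \<in> range (coeff P f)"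
    then obtain n where "x = coeff P f n" by blast
    then show "x \<in> insert \<zero> (coeff P f ` {..deg R f})"
      using deg_aboveD[OF _ assms, of n] by (cases "n \<le> deg R f") auto
  qed
qed simp

text \<open>In \<open>f\<close> plus \<open>x\<close> to the power \<open>D\<close> times
  \<open>g\<close>, with \<open>D\<close> above the degree of \<open>f\<close>, the coefficients of
  the two polynomials do not overlap. Thus one element of \<open>Q\<close> carries the coefficients
  of finitely many.\<close>

lemma combine_coeffs:
  assumes Q: "ideal Q P" and "finite F" "F \<subseteq> Q"
  shows "\<exists>f\<in>Q. \<forall>g\<in>F. range (coeff P g) \<subseteq> range (coeff P f)"
  using assms(2,3)
proof (induction F rule: finite_induct)
  case empty
  then show ?case using idealD(3)[OF Q] by blast
next
  case (insert g F)
  then obtain f where f: "f \<in> Q" "\<forall>g\<in>F. range (coeff P g) \<subseteq> range (coeff P f)" by blast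
  have g: "g \<in> Q" using insert.prems by simp
  have c: "f \<in> carrier P" "g \<in> carrier P" using idealD(2)[OF Q] f(1) g by blast+
  define D where "D = Suc (deg R f)"
  define h where "h = f \<oplus>\<^bsub>P\<^esub> monom P \<one> D \<otimes>\<^bsub>P\<^esub> g"
  have h: "h \<in> Q" unfolding h_def using f(1) g idealD(4,7)[OF Q] by simp
  have high: "coeff P h (n + D) = coeff P g n" for n
    unfolding h_def using c coeff_monom_mult[OF R.one_closed c(2), of D n] deg_aboveD[OF _ c(1), of "n + D"]
    by (simp del: coeff_mult add: D_def add.commute)
  have low: "coeff P h n = coeff P f n" if "n < D" for n
  proof -
    have "coeff P (monom P \<one> D \<otimes>\<^bsub>P\<^esub> g) n = \<zero>"
      using that c by (intro coeff_mult_zero) auto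
    then show ?thesis unfolding h_def using c by (simp del: coeff_mult)
  qed
  \<comment> \<open>The range of \<open>coeff P f\<close> includes the zeros beyond its degree,
    which \<open>h\<close> has to provide as well.\<close>
  have zero: "\<zero> \<in> range (coeff P h)"
    using high[of "Suc (deg R g)"] deg_aboveD[OF _ c(2), of "Suc (deg R g)"] by (metis lessI rangeI)
  have coeff_f: "coeff P f n \<in> range (coeff P h)" for n
  proof (cases "n < D")
    case True
    then show ?thesis using low[of n] by (metis rangeI)
  next
    case False
    then show ?thesis using deg_aboveD[OF _ c(1), of n] zero by (simp add: D_def)
  qed
  have coeff_g: "coeff P g n \<in> range (coeff P h)" for n using high[of n] by (metis rangeI)
  have "range (coeff P f) \<subseteq> range (coeff P h)" "range (coeff P g) \<subseteq> range (coeff P h)"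
    by (intro image_subsetI coeff_f coeff_g)+
  then have "\<forall>g'\<in>insert g F. range (coeff P g') \<subseteq> range (coeff P h)"
    using f(2) by (metis insertE subset_trans)
  then show ?case using h by blast
qed

text \<open>A finite faithful subset of \<open>Q\<close> is merged into one \<open>f\<close> in
  \<open>Q\<close>. Constants annihilating all coefficients of \<open>f\<close> annihilate the
  subset, so these coefficients are faithful, and \<open>f\<close> is regular by McCoy.\<close>

lemma semi_regular_UP_iff:
  assumes Q: "ideal Q P"
  shows "semi_regular_ideal P Q \<longleftrightarrow> Q \<inter> regular_elements P \<noteq> {}"
proof
  assume "semi_regular_ideal P Q"
  then obtain F where F: "finite F" "F \<subseteq> Q" "P.faithful F" using P.semi_regular_iff by blast
  from combine_coeffs[OF Q F(1,2)] obtain f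
    where f: "f \<in> Q" "\<forall>g\<in>F. range (coeff P g) \<subseteq> range (coeff P f)" by blast
  have fc: "f \<in> carrier P" by (rule idealD(2)[OF Q f(1)])
  have "R.faithful (range (coeff P f))" unfolding R.faithful_def
  proof (intro ballI impI)
    fix a assume a: "a \<in> carrier R" "\<forall>x\<in>range (coeff P f). a \<otimes> x = \<zero>"
    have "monom P a 0 \<otimes>\<^bsub>P\<^esub> g = \<zero>\<^bsub>P\<^esub>" if g: "g \<in> F" for g
    proof -
      have gc: "g \<in> carrier P" using F(2) g idealD(1)[OF Q] by blast
      have "a \<otimes> coeff P g n = \<zero>" for n using a(2) f(2) g by blast
      then have "a \<odot>\<^bsub>P\<^esub> g = \<zero>\<^bsub>P\<^esub>" using a(1) gc by (intro up_eqI) auto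
      then show ?thesis using a(1) gc by (simp add: monom_mult_is_smult)
    qed
    then have "monom P a 0 = \<zero>\<^bsub>P\<^esub>" using F(3) a(1) unfolding P.faithful_def by simp
    then have "coeff P (monom P a 0) 0 = \<zero>" by simp
    then show "a = \<zero>" using a(1) by simp
  qed
  then show "Q \<inter> regular_elements P \<noteq> {}" using f(1) regular_UP_iff[OF fc] by blast
next
  assume "Q \<inter> regular_elements P \<noteq> {}"
  then obtain f where f: "f \<in> Q" "f \<in> regular_elements P" by blast
  have "P.faithful {f}"
    unfolding P.faithful_def using P.regular_elementsD(2)[OF f(2)] by blast
  then show "semi_regular_ideal P Q" using P.semi_regular_iff[of Q] Q f(1) by blast
qed

section \<open>Coefficient ideals and non-semi-regular ideals of \<open>R[x]\<close>\<close>

definition content :: "(nat \<Rightarrow> 'a) set \<Rightarrow> 'a set"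
  where "content Q = {coeff P f n | f n. f \<in> Q}"

lemma ideal_content:
  assumes Q: "ideal Q P"
  shows "ideal (content Q) R"
proof -
  note iQ = idealD[OF Q]
  show ?thesis
  proof (rule R.ideal_cringI)
    show "content Q \<subseteq> carrier R" using iQ(2) by (auto simp: content_def)
    have "coeff P \<zero>\<^bsub>P\<^esub> 0 \<in> content Q" unfolding content_def using iQ(3) by blast
    then show "\<zero> \<in> content Q" by simp
  next
    fix x y assume "x \<in> content Q" "y \<in> content Q"
    then obtain f n g m where fg: "f \<in> Q" "x = coeff P f n" "g \<in> Q" "y = coeff P g m"
      unfolding content_def by blast
    have c: "f \<in> carrier P" "g \<in> carrier P" using iQ(2) fg by auto
    \<comment> \<open>The shifts bring both coefficients to the same place \<open>n + m\<close>,
      where they add up.\<close>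
    let ?h = "monom P \<one> m \<otimes>\<^bsub>P\<^esub> f \<oplus>\<^bsub>P\<^esub> monom P \<one> n \<otimes>\<^bsub>P\<^esub> g"
    have "coeff P ?h (n + m) = x \<oplus> y"
      using coeff_monom_mult[OF R.one_closed c(1), of m n] coeff_monom_mult[OF R.one_closed c(2), of n m] c fg
      by (simp del: coeff_mult add: add.commute)
    moreover have "?h \<in> Q" using fg c by (intro iQ(4,7)) auto
    ultimately show "x \<oplus> y \<in> content Q" unfolding content_def by (metis (mono_tags, lifting) mem_Collect_eq)
  next
    fix r x assume r: "r \<in> carrier R" and "x \<in> content Q"
    then obtain f n where f: "f \<in> Q" "x = coeff P f n" unfolding content_def by blast
    then have "r \<otimes> x = coeff P (r \<odot>\<^bsub>P\<^esub> f) n" using r iQ(2) by simp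
    then show "r \<otimes> x \<in> content Q" unfolding content_def using smult_in_ideal[OF Q r f(1)] by blast
  qed
qed

lemma subset_ext_content: "ideal Q P \<Longrightarrow> Q \<subseteq> ext (content Q)"
  using idealD(1) by (fastforce simp: ext_def content_def)

text \<open>A finite faithful set of coefficients, taken from various elements of \<open>Q\<close>,
  occurs among the coefficients of a single one, which is then regular.\<close>

lemma semi_regular_content:
  assumes Q: "ideal Q P" and semi: "semi_regular_ideal R (content Q)"
  shows "semi_regular_ideal P Q"
proof -
  obtain F where F: "finite F" "F \<subseteq> content Q" "R.faithful F" using semi R.semi_regular_iff by blast
  have "\<forall>a\<in>F. \<exists>g\<in>Q. a \<in> range (coeff P g)" using F(2) unfolding content_def by blast
  then obtain G where G: "\<And>a. a \<in> F \<Longrightarrow> G a \<in> Q \<and> a \<in> range (coeff P (G a))" by metis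
  have "finite (G ` F)" "G ` F \<subseteq> Q" using F(1) G by auto
  from combine_coeffs[OF Q this] obtain f
    where f: "f \<in> Q" "\<forall>g\<in>G ` F. range (coeff P g) \<subseteq> range (coeff P f)" by blast
  have "F \<subseteq> range (coeff P f)" using f(2) G by blast
  then have "R.faithful (range (coeff P f))" by (rule R.faithful_mono[OF F(3)])
  then have "f \<in> regular_elements P" using regular_UP_iff[OF idealD(2)[OF Q f(1)]] by simp
  then show ?thesis using semi_regular_UP_iff[OF Q] f(1) by blast
qed

lemma semi_regular_ext:
  assumes p: "ideal p R" and semi: "semi_regular_ideal P (ext p)"
  shows "semi_regular_ideal R p"
proof -
  obtain f where f: "f \<in> ext p" "f \<in> regular_elements P"
    using semi semi_regular_UP_iff[OF ideal_ext[OF p]] by blast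
  have fc: "f \<in> carrier P" using f(1) by (simp add: ext_def)
  have "range (coeff P f) \<subseteq> p" using f(1) by (auto simp: ext_def)
  then show ?thesis
    using p R.semi_regular_iff finite_range_coeff[OF fc] regular_UP_iff[OF fc] f(2) by blast
qed

lemma non_semi_regular_subset_ext:
  assumes Q: "ideal Q P" "\<not> semi_regular_ideal P Q"
  obtains p where "R.max_non_semi_regular p" "Q \<subseteq> ext p"
proof -
  obtain p where p: "R.max_non_semi_regular p" "content Q \<subseteq> p"
    using R.max_non_semi_regular_exists[OF ideal_content[OF Q(1)]] semi_regular_content[OF Q(1)] Q(2)
    by blast
  then have "Q \<subseteq> ext p" using subset_ext_content[OF Q(1)] ext_mono by blast
  then show thesis using that p(1) by blast
qed

lemma ext_non_semi_regular:
  assumes "R.max_non_semi_regular p"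
  shows "ideal (ext p) P" "\<not> semi_regular_ideal P (ext p)"
  using ideal_ext semi_regular_ext R.max_non_semi_regularD[OF assms] by blast+

text \<open>Every non-semi-regular ideal of \<open>R[x]\<close> lies in some \<open>ext p\<close>,
  which is itself not semi-regular, so a maximal one equals it. Conversely, an ideal between
  \<open>ext p\<close> and \<open>ext p'\<close> gives \<open>p \<subseteq> p'\<close> by
  contraction, and maximality of \<open>p\<close> closes the gap.\<close>

theorem max_non_semi_regular_UP:
  "{M. P.max_non_semi_regular M} = ext ` {p. R.max_non_semi_regular p}"
proof (intro equalityI subsetI)
  fix M assume "M \<in> {M. P.max_non_semi_regular M}"
  then have M: "P.max_non_semi_regular M" by simp
  note M' = P.max_non_semi_regularD[OF M]
  obtain p where p: "R.max_non_semi_regular p" "M \<subseteq> ext p"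
    by (rule non_semi_regular_subset_ext[OF M'(1,2)])
  then have "ext p = M" using M'(3) ext_non_semi_regular[OF p(1)] by blast
  then show "M \<in> ext ` {p. R.max_non_semi_regular p}" using p(1) by blast
next
  fix M assume "M \<in> ext ` {p. R.max_non_semi_regular p}"
  then obtain p where p: "R.max_non_semi_regular p" "M = ext p" by blast
  have "Q = ext p" if Q: "ideal Q P" "\<not> semi_regular_ideal P Q" "ext p \<subseteq> Q" for Q
  proof -
    obtain p' where p': "R.max_non_semi_regular p'" "Q \<subseteq> ext p'"
      by (rule non_semi_regular_subset_ext[OF Q(1,2)])
    note i = R.max_non_semi_regularD[OF p(1)] and i' = R.max_non_semi_regularD[OF p'(1)]
    have "contr (ext p) \<subseteq> contr (ext p')" using Q(3) p'(2) by (intro contr_mono) blast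
    then have "p \<subseteq> p'" unfolding contr_ext[OF i(1)] contr_ext[OF i'(1)] .
    then have "p' = p" by (rule i(3)[OF i'(1,2)])
    then show ?thesis using Q(3) p'(2) by blast
  qed
  then have "P.max_non_semi_regular (ext p)"
    unfolding P.max_non_semi_regular_def using ext_non_semi_regular[OF p(1)] by blast
  then show "M \<in> {M. P.max_non_semi_regular M}" using p(2) by simp
qed

section \<open>The two equalities of dimensions\<close>

theorem q_dim_UP:
  assumes env: "injective_envelope R E \<iota>" and env': "injective_envelope P F \<kappa>"
    and noeth: "tau_q_noetherian R E \<iota>"
  shows "q_dim R E \<iota> = q_dim P F \<kappa>"
proof -
  have "height P (ext p) = height R p" if p: "R.max_non_semi_regular p" for p
  proof (rule height_ext[OF R.max_non_semi_regular_prime[OF p]])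
    have "acc_on {I. q_ideal R E \<iota> I}"
      using noeth unfolding tau_q_noetherian_def acc_on_def by simp
    then show "acc_on {I. saturated R (carrier R - p) I}"
      by (rule acc_on_subset)
        (use R.saturated_imp_q_ideal[OF env R.max_non_semi_regularD(1,2)[OF p]] in blast)
  qed
  then show ?thesis
    unfolding q_dim_def R.q_Max_eq[OF env] P.q_Max_eq[OF env'] max_non_semi_regular_UP
    by (simp add: image_image)
qed

theorem q_dim_eq_krull_dim:
  assumes env: "injective_envelope P F \<kappa>"
  shows "q_dim P F \<kappa> = krull_dim (total_quotient_ring P)"
proof -
  let ?M = "{M. P.max_non_semi_regular M}"
  let ?C = "{enat n | n. \<exists>q. chain_to P q n \<and> q \<inter> regular_elements P = {}}"
  have "Sup (height P ` ?M) = Sup ?C"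
  proof (rule antisym)
    show "Sup (height P ` ?M) \<le> Sup ?C"
    proof (rule SUP_least)
      fix M assume "M \<in> ?M"
      then have M: "P.max_non_semi_regular M" by simp
      have "M \<inter> regular_elements P = {}"
        using semi_regular_UP_iff P.max_non_semi_regularD(1,2)[OF M] by blast
      then have "{enat n | n. chain_to P M n} \<subseteq> ?C" by blast
      then show "height P M \<le> Sup ?C" unfolding height_alt by (rule Sup_subset_mono)
    qed
    show "Sup ?C \<le> Sup (height P ` ?M)"
    proof (rule Sup_least)
      fix x assume "x \<in> ?C"
      then obtain n q where x: "x = enat n" and q: "chain_to P q n" "q \<inter> regular_elements P = {}" by blast
      have qp: "primeideal q P" by (rule chain_to_prime[OF q(1)])
      have "\<not> semi_regular_ideal P q" using semi_regular_UP_iff[OF primeD(1)[OF qp]] q(2) by blast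
      then obtain p where p: "R.max_non_semi_regular p" "q \<subseteq> ext p"
        by (rule non_semi_regular_subset_ext[OF primeD(1)[OF qp]])
      have M: "ext p \<in> ?M" using max_non_semi_regular_UP p(1) by blast
      \<comment> \<open>A chain ending at a prime without regular elements is carried up to one of
        the same length ending at a maximal \<open>q\<close>-ideal above it.\<close>
      have "chain_to P (ext p) n"
        by (rule chain_to_enlarge[OF q(1) primeideal_ext[OF R.max_non_semi_regular_prime[OF p(1)]] p(2)])
      then have "x \<le> height P (ext p)" unfolding height_alt x by (intro Sup_upper) blast
      also have "\<dots> \<le> Sup (height P ` ?M)" by (rule SUP_upper[OF M])
      finally show "x \<le> Sup (height P ` ?M)" .
    qed
  qed
  then show ?thesis
    unfolding q_dim_def P.q_Max_eq[OF env] P.krull_dim_total_quotient_ring .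
qed

end

theorem theorem3p10:
  fixes R :: "('a, 'r) ring_scheme"
    and E :: "('a, 'e, 'm) module_scheme" and \<iota> :: "'a \<Rightarrow> 'e"
    and F :: "(nat \<Rightarrow> 'a, 'f, 'n) module_scheme" and \<kappa> :: "(nat \<Rightarrow> 'a) \<Rightarrow> 'f"
  assumes "cring R"
    and "injective_envelope R E \<iota>"
    and "injective_envelope (UP R) F \<kappa>"
    and "tau_q_noetherian R E \<iota>"
  shows "q_dim R E \<iota> = q_dim (UP R) F \<kappa> \<and>
    q_dim (UP R) F \<kappa> = krull_dim (total_quotient_ring (UP R))"
proof -
  interpret UP_cring R "UP R" by (rule UP_cring.intro[OF assms(1)]) simp
  show ?thesis
    using q_dim_UP[OF assms(2-4)] q_dim_eq_krull_dim[OF assms(3)] by simp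
qed

end
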